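(* For every $k\ge 3$, the cycle query $$C_k = S_1(x_1,x_2), S_2(x_2,x_3),\dots,S_k(x_k,x_1),$$ on input in which all relations have the same size $M$ in bits, can be computed by an MPC algorithm with $p$ servers in at most $\lceil k/2\rceil$ rounds with load $\tilde{O}\big(M/p^{2/k}\big)$.
   Context: The query asks for all tuples $(x_1,\dots,x_k)$ satisfying all the binary relations (natural join of $k$ distinct relations). All relations have $m$ tuples over a domain $[n]$ and size $M=2m\log n$ bits. MPC model. There are $p$ servers connected by a complete network of private channels. Computation proceeds in synchronous rounds, each consisting of a communication phase (servers exchange data) and a computation phase (unrestricted local computation). The input is initially partitioned evenly among the $p$ servers. At the end, the union of the outputs of the servers must be the full set of answers to the query. The load is the maximum number of bits received by any server during any round. Conventions. $k$ is fixed (constants may depend on it). $\tilde O$ hides factors polylogarithmic in $p$. Algorithms may use randomness (random hash functions), and the load bound holds with high probability (probability tending to $1$ as $p\to\infty$, uniformly over inputs). Data statistics, namely relation sizes and information about heavy hitters (values, or tuples of values, of high frequency in a relation, with their frequencies), are available to the servers. Relation sizes are large compared with $p$ ($m\ge p^{c}$ for a suitable constant $c$ depending only on the query). There is no other assumption on the data distribution. *)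

theory Defs
  imports "HOL-Probability.Probability"
begin

subsection \<open>Natural joins of binary relations\<close>

text \<open>
  A query is given by its list of atoms: the \<open>j\<close>-th entry \<open>(u, v)\<close> is the atom
  \<open>S\<^sub>j(x\<^sub>u, x\<^sub>v)\<close>.  Every atom has its own relation symbol (its position in the list),
  so there are no self-joins.  Variables and atoms are numbered from 0, and the domain
  \<open>[n]\<close> is \<open>{1..n}\<close>.
\<close>

type_synonym query = "(nat \<times> nat) list"
type_synonym db = "nat \<Rightarrow> (nat \<times> nat) set"
type_synonym fact = "nat \<times> nat \<times> nat"

definition cycle_query :: "nat \<Rightarrow> query" where
  "cycle_query k = map (\<lambda>j. (j, (j + 1) mod k)) [0..<k]"

definition answers :: "nat \<Rightarrow> query \<Rightarrow> db \<Rightarrow> nat list set" where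
  "answers k q S =
     {x. length x = k \<and> (\<forall>j<length q. (x ! fst (q ! j), x ! snd (q ! j)) \<in> S j)}"

definition is_input :: "query \<Rightarrow> nat \<Rightarrow> nat \<Rightarrow> db \<Rightarrow> bool" where
  "is_input q n m S \<longleftrightarrow>
     (\<forall>j<length q. S j \<subseteq> {1..n} \<times> {1..n} \<and> card (S j) = m)"

definition size_bits :: "nat \<Rightarrow> nat \<Rightarrow> real" where
  "size_bits n m = 2 * real m * log 2 (real n)"

definition facts :: "query \<Rightarrow> db \<Rightarrow> fact set" where
  "facts q S = {(j, a, b). j < length q \<and> (a, b) \<in> S j}"

text \<open>The servers are \<open>0, \<dots>, p - 1\<close>; server \<open>s\<close> initially holds the tuples \<open>D s\<close>.\<close>

definition even_partition :: "nat \<Rightarrow> query \<Rightarrow> db \<Rightarrow> (nat \<Rightarrow> fact set) \<Rightarrow> bool" where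
  "even_partition p q S D \<longleftrightarrow>
     (\<Union>s<p. D s) = facts q S \<and> disjoint_family_on D {..<p} \<and>
     (\<forall>s<p. \<lfloor>real (card (facts q S)) / real p\<rfloor> \<le> int (card (D s)) \<and>
            int (card (D s)) \<le> \<lceil>real (card (facts q S)) / real p\<rceil>)"


subsection \<open>Data statistics\<close>

text \<open>
  A pattern fixes the values of a subset of the two attributes of a relation, \<open>None\<close> standing
  for an attribute that is not fixed.  A pattern is a heavy hitter of \<open>R\<close> if its frequency is
  at least \<open>|R| / p\<close>.  The statistics consist of all heavy hitters with their frequencies.
  The pattern that fixes nothing is always heavy, so the relation sizes are included; a pattern
  that fixes both values has frequency at most 1, so it is never heavy once \<open>|R| > p\<close>.
\<close>

type_synonym pattern = "nat option \<times> nat option"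
type_synonym statistics = "nat \<Rightarrow> pattern \<Rightarrow> nat"

definition freq :: "(nat \<times> nat) set \<Rightarrow> pattern \<Rightarrow> nat" where
  "freq R h = card {(a, b) \<in> R. fst h \<in> {None, Some a} \<and> snd h \<in> {None, Some b}}"

definition data_statistics :: "nat \<Rightarrow> query \<Rightarrow> db \<Rightarrow> statistics" where
  "data_statistics p q S =
     (\<lambda>j h. if j < length q \<and> real (freq (S j) h) \<ge> real (card (S j)) / real p
            then freq (S j) h else 0)"


subsection \<open>MPC algorithms\<close>

text \<open>
  Local computation is unrestricted, so without loss of generality a server forwards no state
  other than everything it has learned: its name, the statistics, the random seed, its part of
  the input, and for each completed round the bit strings received from the individual senders.
  The seed is common to all servers (shared random hash functions) and is drawn independently
  of the input.  The function \<open>message\<close> maps the view of the sender and the name of the receiver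
  to the bit string transmitted in the next round; the number of that round can be read off
  the view.
\<close>

record server_view =
  self :: nat
  stats :: statistics
  seed :: nat
  local_input :: "fact set"
  received :: "(nat \<Rightarrow> bool list) list"

record mpc_algorithm =
  num_rounds :: nat
  seed_dist :: "nat pmf"
  message :: "server_view \<Rightarrow> nat \<Rightarrow> bool list"
  local_output :: "server_view \<Rightarrow> nat list set"

primrec view_after ::
  "mpc_algorithm \<Rightarrow> nat \<Rightarrow> statistics \<Rightarrow> (nat \<Rightarrow> fact set) \<Rightarrow> nat \<Rightarrow> nat \<Rightarrow> nat \<Rightarrow> server_view"
where
  "view_after A p st D \<omega> 0 = (\<lambda>s.
     \<lparr>self = s, stats = st, seed = \<omega>, local_input = D s, received = []\<rparr>)"
| "view_after A p st D \<omega> (Suc r) = (\<lambda>s.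
     (view_after A p st D \<omega> r s)
       \<lparr>received := received (view_after A p st D \<omega> r s) @
          [\<lambda>t. if t < p then message A (view_after A p st D \<omega> r t) s else []]\<rparr>)"

definition bits_received ::
  "mpc_algorithm \<Rightarrow> nat \<Rightarrow> statistics \<Rightarrow> (nat \<Rightarrow> fact set) \<Rightarrow> nat \<Rightarrow> nat \<Rightarrow> nat \<Rightarrow> nat"
where
  "bits_received A p st D \<omega> r s =
     (\<Sum>t<p. length (message A (view_after A p st D \<omega> r t) s))"

text \<open>The additional 0 only matters for algorithms without communication rounds.\<close>

definition load ::
  "mpc_algorithm \<Rightarrow> nat \<Rightarrow> statistics \<Rightarrow> (nat \<Rightarrow> fact set) \<Rightarrow> nat \<Rightarrow> nat"
where
  "load A p st D \<omega> =
     Max (insert 0 {bits_received A p st D \<omega> r s | r s. r < num_rounds A \<and> s < p})"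

definition mpc_output ::
  "mpc_algorithm \<Rightarrow> nat \<Rightarrow> statistics \<Rightarrow> (nat \<Rightarrow> fact set) \<Rightarrow> nat \<Rightarrow> nat list set"
where
  "mpc_output A p st D \<omega> = (\<Union>s<p. local_output A (view_after A p st D \<omega> (num_rounds A) s))"

end

theory Submission
  imports Defs
begin

text \<open>
  Two rounds always suffice.  Let \<open>\<ell> = \<lceil>p\<^bsup>1/k\<^esup>\<rceil>\<close>.  A value of a variable is heavy if it occurs at least
  \<open>m / \<ell>\<close> times in one of the two relations of the variable, medium if it is not heavy but occurs at
  least \<open>m / p\<close> times, and light otherwise; the statistics reveal these classes.  In the first round,
  the facts between heavy and medium values, of which there are \<open>O(p\<^sup>2)\<close>, are broadcast, and all
  other facts are hashed into \<open>p\<close> buckets by each of their light values.  So for every light value one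
  server knows all its facts.  It can remove those that are dangling with respect to a given choice of
  heavy values, and in the second round it sends the others to a hypercube for that choice.

  For a fixed choice of the heavy values, the variables that are not heavy form paths.  A variable on
  a path of length at least three (or on the full cycle) gets \<open>\<ell>\<close> buckets.  The two variables of a path
  of length two share \<open>\<ell>\<^sup>2\<close> buckets, by which their only relation is partitioned.  A variable between
  two heavy ones gets \<open>1 + \<ell>\<^sup>2 d / m\<close> buckets, where \<open>d\<close> is the degree of the value of its successor;
  since these degrees sum to at most \<open>m\<close> and there are \<open>O(\<ell>)\<close> heavy values, all hypercubes together
  have \<open>O(\<ell>\<^sup>k) = O(p)\<close> cells.  After the removal of dangling facts, a cell receives \<open>O(m / \<ell>\<^sup>2)\<close> facts of
  every relation, up to a logarithmic factor.
\<close>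

subsection \<open>Concentration of hash buckets\<close>

lemma exp_le_one_plus_two:
  fixes x :: real
  assumes "0 \<le> x" "x \<le> 1"
  shows "exp x \<le> 1 + 2 * x"
proof -
  have "exp x \<le> 1 + x + x\<^sup>2" using exp_bound[of x] assms by simp
  moreover have "x\<^sup>2 \<le> x" using assms by (simp add: power2_eq_square mult_left_le)
  ultimately show ?thesis by simp
qed

text \<open>The exponent vanishes except at \<open>y = c\<close>, so the mean is
  \<open>1 + (exp u - 1) / q\<close>, where \<open>exp u - 1\<close> is at most
  \<open>2 * u\<close>.\<close>

lemma expectation_exp_bucket_le:
  fixes u :: real
  assumes "0 \<le> u" "u \<le> 1" "c < (q::nat)"
  shows "measure_pmf.expectation (pmf_of_set {..<q}) (\<lambda>y. exp (u * of_bool (y = c))) \<le> exp (2 * u / q)"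
proof -
  have q: "q > 0" using assms by simp
  have "measure_pmf.expectation (pmf_of_set {..<q}) (\<lambda>y. exp (u * of_bool (y = c)))
      = (\<Sum>y<q. exp (u * of_bool (y = c))) / q"
    using q by (subst integral_pmf_of_set) (auto simp: lessThan_empty_iff)
  also have "(\<Sum>y<q. exp (u * of_bool (y = c))) = (\<Sum>y<q. 1 + (if y = c then exp u - 1 else 0))"
    by (intro sum.cong) auto
  also have "\<dots> = q + (exp u - 1)"
    using assms by (simp add: sum.distrib)
  also have "\<dots> / q \<le> (q + 2 * u) / q"
    using exp_le_one_plus_two[OF assms(1,2)] by (intro divide_right_mono) auto
  also have "\<dots> = 1 + 2 * u / q" using q by (simp add: field_simps)
  also have "\<dots> \<le> exp (2 * u / q)" by (rule exp_ge_add_one_self)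
  finally show ?thesis .
qed

text \<open>Exponential Markov inequality with rate \<open>1 / b\<close>, for which \<open>exp x \<le> 1 + 2 * x\<close>
  applies to every single weight.\<close>

lemma bucket_tail:
  fixes w :: "'i \<Rightarrow> real" and P :: "'i \<Rightarrow> nat pmf"
  assumes fin: "finite I" and JI: "J \<subseteq> I"
    and P: "\<And>x. x \<in> J \<Longrightarrow> P x = pmf_of_set {..<q}" and c: "c < q"
    and w: "\<And>x. x \<in> J \<Longrightarrow> 0 \<le> w x \<and> w x \<le> b" and b: "b > 0"
  shows "measure_pmf.prob (Pi_pmf I d P) {g. t \<le> (\<Sum>x\<in>J. w x * of_bool (g x = c))}
           \<le> exp ((2 * (\<Sum>x\<in>J. w x) / q - t) / b)"
proof -
  \<comment> \<open>Coordinates outside \<open>J\<close> get the constant factor 1, so the product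
    formula over all of \<open>I\<close> leaves a product over \<open>J\<close>.\<close>
  define f where "f x y = (if x \<in> J then exp (w x / b * of_bool (y = c)) else 1)" for x and y :: nat
  let ?M = "Pi_pmf I d P"
  have finJ: "finite J" using fin JI finite_subset by blast
  have f_nonneg: "f x y \<ge> 0" for x y by (simp add: f_def)
  have f_out: "f x = (\<lambda>_. 1)" if "x \<notin> J" for x
    using that by (simp add: f_def fun_eq_iff)
  have int: "integrable (measure_pmf (P x)) (f x)" if "x \<in> I" for x
  proof (cases "x \<in> J")
    case True
    then show ?thesis using c
      by (auto simp: P lessThan_empty_iff intro!: integrable_measure_pmf_finite)
  next
    case False
    then show ?thesis by (simp add: f_out)
  qed
  have prodf: "(\<Prod>x\<in>I. f x (g x)) = exp ((\<Sum>x\<in>J. w x * of_bool (g x = c)) / b)" for g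
  proof -
    have "(\<Prod>x\<in>I. f x (g x)) = (\<Prod>x\<in>J. f x (g x))"
      using fin JI by (intro prod.mono_neutral_right) (auto simp: f_def)
    also have "\<dots> = exp (\<Sum>x\<in>J. w x / b * of_bool (g x = c))"
      using finJ by (simp add: f_def exp_sum)
    finally show ?thesis by (simp add: sum_divide_distrib)
  qed
  have "measure_pmf.prob ?M {g. t \<le> (\<Sum>x\<in>J. w x * of_bool (g x = c))}
     = measure_pmf.expectation ?M (indicator {g. t \<le> (\<Sum>x\<in>J. w x * of_bool (g x = c))})"
    by simp
  also have "\<dots> \<le> measure_pmf.expectation ?M (\<lambda>g. exp (- t / b) * (\<Prod>x\<in>I. f x (g x)))"
  proof (rule integral_mono)
    show "integrable (measure_pmf ?M) (\<lambda>g. exp (- t / b) * (\<Prod>x\<in>I. f x (g x)))"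
      by (intro integrable_mult_right integrable_prod_Pi_pmf fin int)
    fix g
    show "indicator {g. t \<le> (\<Sum>x\<in>J. w x * of_bool (g x = c))} g \<le> exp (- t / b) * (\<Prod>x\<in>I. f x (g x))"
      using b by (auto simp: prodf indicator_def exp_add[symmetric] diff_divide_distrib[symmetric])
  qed (simp add: measure_pmf.integrable_const_bound[where B=1])
  also have "\<dots> = exp (- t / b) * (\<Prod>x\<in>I. measure_pmf.expectation (P x) (f x))"
    by (subst expectation_prod_Pi_pmf[symmetric]) (use fin int f_nonneg in auto)
  also have "(\<Prod>x\<in>I. measure_pmf.expectation (P x) (f x)) = (\<Prod>x\<in>J. measure_pmf.expectation (P x) (f x))"
    using fin JI by (intro prod.mono_neutral_right) (auto simp: f_out)
  also have "\<dots> \<le> (\<Prod>x\<in>J. exp (2 * (w x / b) / q))"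
  proof (intro prod_mono conjI)
    fix x assume x: "x \<in> J"
    show "0 \<le> measure_pmf.expectation (P x) (f x)"
      by (intro integral_nonneg_AE) (auto simp: f_def)
    have "measure_pmf.expectation (P x) (f x)
        = measure_pmf.expectation (pmf_of_set {..<q}) (\<lambda>y. exp (w x / b * of_bool (y = c)))"
      using x by (intro arg_cong2[where f = measure_pmf.expectation]) (auto simp: f_def P fun_eq_iff)
    also have "\<dots> \<le> exp (2 * (w x / b) / q)"
      using w[OF x] b c by (intro expectation_exp_bucket_le) auto
    finally show "measure_pmf.expectation (P x) (f x) \<le> exp (2 * (w x / b) / q)" .
  qed
  also have "(\<Prod>x\<in>J. exp (2 * (w x / b) / q)) = exp (2 * (\<Sum>x\<in>J. w x) / q / b)"
    using finJ by (simp add: exp_sum[symmetric] sum_divide_distrib[symmetric] sum_distrib_left[symmetric])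
  finally show ?thesis by (simp add: exp_add[symmetric] diff_divide_distrib)
qed

text \<open>Conditioning on the first coordinate: a bound valid for each of its values survives
  averaging over it.\<close>

lemma prob_pair_pmf_le:
  assumes "\<And>x. measure_pmf.prob N {y. (x, y) \<in> X} \<le> e"
  shows "measure_pmf.prob (pair_pmf M N) X \<le> e"
proof -
  have e: "e \<ge> 0" using assms[of undefined] by (meson measure_nonneg order_trans)
  have "emeasure (measure_pmf (pair_pmf M N)) X = (\<integral>\<^sup>+x. indicator X x \<partial>pair_pmf M N)"
    by simp
  also have "\<dots> = (\<integral>\<^sup>+a. \<integral>\<^sup>+b. indicator X (a, b) \<partial>N \<partial>M)" by (rule nn_integral_pair_pmf')
  also have "\<dots> = (\<integral>\<^sup>+a. emeasure N {y. (a, y) \<in> X} \<partial>M)"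
  proof (rule nn_integral_cong)
    fix a
    have "(\<integral>\<^sup>+b. indicator X (a, b) \<partial>N) = (\<integral>\<^sup>+b. indicator {y. (a, y) \<in> X} b \<partial>N)"
      by (rule nn_integral_cong) (auto simp: indicator_def)
    then show "(\<integral>\<^sup>+b. indicator X (a, b) \<partial>N) = emeasure N {y. (a, y) \<in> X}" by simp
  qed
  also have "\<dots> \<le> (\<integral>\<^sup>+a. ennreal e \<partial>M)"
    using assms by (intro nn_integral_mono) (simp add: measure_pmf.emeasure_eq_measure ennreal_leI)
  also have "\<dots> = ennreal e" by simp
  finally show ?thesis using e by (simp add: measure_pmf.emeasure_eq_measure)
qed

text \<open>The first coordinates are revealed before the second ones: given the former, the number of
  edges of a bucket is a sum of independent weights.\<close>

lemma grid_tail: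
  fixes P :: "'i \<Rightarrow> nat pmf" and E :: "('a \<times> 'b) set" and u :: "'a \<Rightarrow> 'i" and v :: "'b \<Rightarrow> 'i"
  assumes fin: "finite I" "finite E"
    and inj: "inj_on v (snd ` E)"
    and disj: "u ` fst ` E \<inter> v ` snd ` E = {}" and uI: "u ` fst ` E \<subseteq> I" and vI: "v ` snd ` E \<subseteq> I"
    and P: "\<And>b. b \<in> snd ` E \<Longrightarrow> P (v b) = pmf_of_set {..<q}" and c': "c' < q"
    and B: "B > 0"
  shows "measure_pmf.prob (Pi_pmf I d P)
      {g. (\<forall>b\<in>snd ` E. real (card {a. (a, b) \<in> E \<and> g (u a) = c}) \<le> B) \<and>
          real (card {(a, b) \<in> E. g (u a) = c}) \<le> W \<and>
          t \<le> real (card {(a, b) \<in> E. g (u a) = c \<and> g (v b) = c'})}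
      \<le> exp ((2 * W / q - t) / B)"
proof -
  define J where "J = v ` snd ` E"
  have finJ: "finite J" unfolding J_def using fin by auto
  define N where "N g b = real (card {a. (a, b) \<in> E \<and> g (u a) = c})" for g :: "'i \<Rightarrow> nat" and b
  have fa: "finite {a. (a, b) \<in> E \<and> g (u a) = c}" for g :: "'i \<Rightarrow> nat" and b
    by (rule finite_subset[of _ "fst ` E"]) (use fin in \<open>force+\<close>)
  have row: "real (card {(a, b) \<in> E. g (u a) = c \<and> Q b}) = (\<Sum>b\<in>snd ` E. N g b * of_bool (Q b))"
    for g :: "'i \<Rightarrow> nat" and Q
  proof -
    have "{(a, b) \<in> E. g (u a) = c \<and> Q b}
        = (\<lambda>(b, a). (a, b)) ` (SIGMA b:snd ` E. if Q b then {a. (a, b) \<in> E \<and> g (u a) = c} else {})"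
      by (force split: if_splits)
    then have "card {(a, b) \<in> E. g (u a) = c \<and> Q b}
        = card (SIGMA b:snd ` E. if Q b then {a. (a, b) \<in> E \<and> g (u a) = c} else {})"
      by (simp only:) (rule card_image, auto simp: inj_on_def)
    also have "\<dots> = (\<Sum>b\<in>snd ` E. card (if Q b then {a. (a, b) \<in> E \<and> g (u a) = c} else {}))"
      using fin fa by (intro card_SigmaI) auto
    finally show ?thesis
      by (auto simp: N_def of_bool_def intro!: sum.cong)
  qed
  define X where "X = {g. (\<forall>b\<in>snd ` E. N g b \<le> B) \<and> (\<Sum>b\<in>snd ` E. N g b) \<le> W \<and>
      t \<le> (\<Sum>b\<in>snd ` E. N g b * of_bool (g (v b) = c'))}"
  have uJ: "u a \<in> I - J" if "(a, b) \<in> E" for a b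
    using that disj uI by (force simp: J_def)
  have vJ: "v b \<in> J" if "b \<in> snd ` E" for b
    using that by (simp add: J_def)
  define glue where "glue = (\<lambda>f g x. if x \<in> I - J then f x else g x :: nat)"
  have IJ: "I = (I - J) \<union> J" using vI by (auto simp: J_def)
  \<comment> \<open>A function on \<open>I\<close> is glued from two independent ones: the part on
    \<open>I - J\<close> decides all hashes of left ends, the part on \<open>J\<close> those of
    right ends.\<close>
  have split: "Pi_pmf I d P = map_pmf (\<lambda>(f, g). glue f g)
       (pair_pmf (Pi_pmf (I - J) d P) (Pi_pmf J d P))"
    unfolding glue_def by (subst IJ, rule Pi_pmf_union) (use fin finJ in auto)
  have Nglue: "N (glue f g) = N f" for f g
  proof
    fix b
    have "{a. (a, b) \<in> E \<and> glue f g (u a) = c} = {a. (a, b) \<in> E \<and> f (u a) = c}"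
      using uJ by (auto simp: glue_def)
    then show "N (glue f g) b = N f b" by (simp add: N_def)
  qed
  have glue_v: "glue f g (v b) = g (v b)" if "b \<in> snd ` E" for f g b
    using vJ[OF that] by (simp add: glue_def)
  \<comment> \<open>The first two conditions of \<open>X\<close> depend on \<open>f\<close> alone.
    If they fail, the event is empty; otherwise the \<open>N f b\<close> are constants, each at most
    \<open>B\<close> with sum at most \<open>W\<close>, and \<open>bucket_tail\<close>
    applies.\<close>
  have step: "measure_pmf.prob (Pi_pmf J d P) {g. glue f g \<in> X}
      \<le> exp ((2 * W / q - t) / B)" for f
  proof (cases "(\<forall>b\<in>snd ` E. N f b \<le> B) \<and> (\<Sum>b\<in>snd ` E. N f b) \<le> W")
    case True
    define w where "w x = N f (the_inv_into (snd ` E) v x)" for x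
    have wv: "w (v b) = N f b" if "b \<in> snd ` E" for b
      using that inj by (simp add: w_def the_inv_into_f_f)
    have sums: "(\<Sum>x\<in>J. w x * h x) = (\<Sum>b\<in>snd ` E. N f b * h (v b))" for h
      unfolding J_def by (subst sum.reindex[OF inj]) (simp add: wv)
    have X: "{g. glue f g \<in> X} = {g. t \<le> (\<Sum>x\<in>J. w x * of_bool (g x = c'))}"
      using True unfolding X_def sums by (simp add: Nglue glue_v)
    have tail: "measure_pmf.prob (Pi_pmf J d P) {g. t \<le> (\<Sum>x\<in>J. w x * of_bool (g x = c'))}
        \<le> exp ((2 * (\<Sum>x\<in>J. w x) / q - t) / B)"
    proof (rule bucket_tail)
      show "P x = pmf_of_set {..<q}" if "x \<in> J" for x using that P by (auto simp: J_def)
      show "0 \<le> w x \<and> w x \<le> B" if x: "x \<in> J" for x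
      proof -
        obtain b where b: "b \<in> snd ` E" "x = v b" using x unfolding J_def by blast
        moreover have "N f b \<ge> 0" by (simp add: N_def)
        moreover have "N f b \<le> B" using True b by blast
        ultimately show ?thesis using b wv by simp
      qed
    qed (use finJ c' B in auto)
    have "(\<Sum>x\<in>J. w x) \<le> W" using sums[of "\<lambda>_. 1"] True by simp
    then have "exp ((2 * (\<Sum>x\<in>J. w x) / q - t) / B) \<le> exp ((2 * W / q - t) / B)"
      using B by (simp add: divide_right_mono)
    with tail show ?thesis unfolding X by (rule order_trans)
  next
    case False
    then have "{g. glue f g \<in> X} = {}" unfolding X_def by (simp add: Nglue) blast
    then show ?thesis by simp
  qed
  have "measure_pmf.prob (Pi_pmf I d P) X
      = measure_pmf.prob (pair_pmf (Pi_pmf (I - J) d P) (Pi_pmf J d P)) ((\<lambda>(f, g). glue f g) -` X)"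
    unfolding split by (rule measure_map_pmf)
  also have "\<dots> \<le> exp ((2 * W / q - t) / B)"
    using step by (intro prob_pair_pmf_le) simp
  also have "X = {g. (\<forall>b\<in>snd ` E. real (card {a. (a, b) \<in> E \<and> g (u a) = c}) \<le> B) \<and>
          real (card {(a, b) \<in> E. g (u a) = c}) \<le> W \<and>
          t \<le> real (card {(a, b) \<in> E. g (u a) = c \<and> g (v b) = c'})}"
  proof -
    have "real (card {(a, b) \<in> E. g (u a) = c}) = (\<Sum>b\<in>snd ` E. N g b)" for g :: "'i \<Rightarrow> nat"
      using row[of g "\<lambda>_. True"] by simp
    moreover have "real (card {(a, b) \<in> E. g (u a) = c \<and> g (v b) = c'})
        = (\<Sum>b\<in>snd ` E. N g b * of_bool (g (v b) = c'))" for g :: "'i \<Rightarrow> nat"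
      by (rule row)
    ultimately show ?thesis unfolding X_def N_def[symmetric] by (simp only:)
  qed
  finally show ?thesis .
qed

text \<open>Turns the size of a bucket into a weighted sum over left ends, the form that
  \<open>bucket_tail\<close> bounds.\<close>

lemma real_card_rows:
  assumes "finite R" "finite A" "fst ` R \<subseteq> A"
  shows "real (card {(a, b) \<in> R. Q a}) = (\<Sum>a\<in>A. real (card {b. (a, b) \<in> R}) * of_bool (Q a))"
proof -
  have fin: "finite {b. (a, b) \<in> R}" for a
    using finite_imageI[OF assms(1), of snd] by (rule finite_subset[rotated]) force
  have "{(a, b) \<in> R. Q a} = (SIGMA a:A. if Q a then {b. (a, b) \<in> R} else {})"
    using assms(3) by (force split: if_splits)
  then have "card {(a, b) \<in> R. Q a} = (\<Sum>a\<in>A. card (if Q a then {b. (a, b) \<in> R} else {}))"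
    using assms(2) fin by (simp only:) (intro card_SigmaI, auto)
  then show ?thesis by (auto simp: of_bool_def intro!: sum.cong)
qed

lemma prob_UN_le:
  assumes "finite I" "\<And>i. i \<in> I \<Longrightarrow> measure_pmf.prob M (A i) \<le> e"
  shows "measure_pmf.prob M (\<Union>i\<in>I. A i) \<le> real (card I) * e"
proof -
  have "measure_pmf.prob M (\<Union>i\<in>I. A i) \<le> (\<Sum>i\<in>I. measure_pmf.prob M (A i))"
    using assms(1) by (intro measure_pmf.finite_measure_subadditive_finite) auto
  also have "\<dots> \<le> (\<Sum>i\<in>I. e)" using assms(2) by (intro sum_mono)
  finally show ?thesis by simp
qed

subsection \<open>Counting\<close>

lemma sum_card_fibers_le:
  assumes "finite X" "finite T"
  shows "(\<Sum>t\<in>T. card {x \<in> X. f x = t}) \<le> card X"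
proof -
  have "(\<Sum>t\<in>T. card {x \<in> X. f x = t}) = card (\<Union>t\<in>T. {x \<in> X. f x = t})"
    using assms by (intro card_UN_disjoint[symmetric]) auto
  also have "\<dots> \<le> card X" using assms by (intro card_mono) auto
  finally show ?thesis .
qed

lemma sum_card_rows_le:
  assumes "finite R" "finite A"
  shows "(\<Sum>a\<in>A. card {b. (a, b) \<in> R}) \<le> card R"
proof -
  have "card {b. (a, b) \<in> R} = card {x \<in> R. fst x = a}" for a
    by (rule bij_betw_same_card[of "Pair a"]) (auto simp: bij_betw_def inj_on_def)
  then show ?thesis using sum_card_fibers_le[OF assms, of fst] by simp
qed

text \<open>Rows of different values are disjoint, and every value in \<open>A\<close> claims at
  least a \<open>1 / \<theta>\<close> share of \<open>R\<close>.\<close>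

lemma card_frequent_le:
  assumes R: "finite R" "card R > 0" and A: "finite A" "\<And>a. a \<in> A \<Longrightarrow> card R \<le> \<theta> * card {b. (a, b) \<in> R}"
  shows "card A \<le> \<theta>"
proof -
  have "card A * card R \<le> (\<Sum>a\<in>A. \<theta> * card {b. (a, b) \<in> R})"
    using sum_bounded_below[of A "card R" "\<lambda>a. \<theta> * card {b. (a, b) \<in> R}"] A(2) by simp
  also have "\<dots> \<le> \<theta> * card R"
    using sum_card_rows_le[OF R(1) A(1)] by (simp add: sum_distrib_left[symmetric])
  finally show ?thesis using R(2) by simp
qed

text \<open>On a residue class modulo \<open>p\<close>, division by \<open>p\<close> is
  injective.\<close>

lemma card_mod_class_le: "p > 0 \<Longrightarrow> card {j. j < N \<and> j mod p = s} \<le> N div p + (1 :: nat)"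
proof -
  assume "p > 0"
  have "card {j. j < N \<and> j mod p = s} \<le> card {..N div p}"
  proof (rule card_inj_on_le)
    show "inj_on (\<lambda>j. j div p) {j. j < N \<and> j mod p = s}"
      by (rule inj_onI) (metis (mono_tags, lifting) div_mult_mod_eq mem_Collect_eq)
  qed (auto intro: div_le_mono)
  then show ?thesis by simp
qed

subsection \<open>Encoding sets of facts\<close>

text \<open>Code words of one fixed length can be cut apart again; the length is positive so that
  lists of different lengths stay distinguishable.\<close>

lemma inj_on_concat_equal_length:
  assumes "\<And>x. x \<in> A \<Longrightarrow> length (f x) = L" "L > 0" "inj_on f A"
  shows "inj_on (\<lambda>xs. concat (map f xs)) (lists A)"
proof (rule inj_onI)
  fix xs ys assume "xs \<in> lists A" "ys \<in> lists A" "concat (map f xs) = concat (map f ys)"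
  then show "xs = ys"
  proof (induction xs arbitrary: ys rule: list.induct)
    case Nil
    then show ?case using assms(1,2) by (cases ys) auto
  next
    case (Cons x xs)
    show ?case
    proof (cases ys)
      case Nil
      then have "f x = []" "x \<in> A" using Cons.prems by auto
      then show ?thesis using assms(1)[of x] assms(2) by auto
    next
      case (Cons y ys')
      then have mem: "x \<in> A" "y \<in> A" "xs \<in> lists A" "ys' \<in> lists A"
        and eq: "f x @ concat (map f xs) = f y @ concat (map f ys')"
        using Cons.prems by auto
      then have "f x = f y" "concat (map f xs) = concat (map f ys')"
        using assms(1)[OF mem(1)] assms(1)[OF mem(2)] by (simp_all add: append_eq_append_conv)
      then show ?thesis using mem Cons.IH[of ys'] inj_onD[OF assms(3), of x y] \<open>ys = y # ys'\<close> by simp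
    qed
  qed
qed

lemma card_bool_lists: "finite {xs :: bool list. length xs = L} \<and> card {xs :: bool list. length xs = L} = 2 ^ L"
  using card_lists_length_eq[of "UNIV :: bool set" L] finite_lists_length_eq[of "UNIV :: bool set" L]
  by simp

text \<open>A set is written as the code words of its elements in a chosen order; the list of
  elements, hence the set, can be recovered.\<close>

lemma ex_set_code:
  assumes fin: "finite (U :: 'a set)" and card: "card U \<le> 2 ^ L" and L: "L > 0"
  shows "\<exists>code :: 'a set \<Rightarrow> bool list. inj_on code (Pow U) \<and> (\<forall>F\<subseteq>U. length (code F) = L * card F)"
proof -
  obtain f :: "'a \<Rightarrow> bool list" where f: "f ` U \<subseteq> {xs. length xs = L}" "inj_on f U"
    using card_le_inj[OF fin, of "{xs :: bool list. length xs = L}"] card card_bool_lists[of L] by auto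
  have "\<exists>xs. set xs = F \<and> distinct xs" if "F \<subseteq> U" for F
    using finite_distinct_list[OF finite_subset[OF that fin]] by blast
  then obtain enum where enum: "\<And>F. F \<subseteq> U \<Longrightarrow> set (enum F) = F \<and> distinct (enum F)"
    by metis
  have "inj_on (\<lambda>F. concat (map f (enum F))) (Pow U)"
  proof (rule inj_onI)
    fix F G assume F: "F \<in> Pow U" and G: "G \<in> Pow U"
      and eq: "concat (map f (enum F)) = concat (map f (enum G))"
    have "inj_on (\<lambda>xs. concat (map f xs)) (lists U)"
      using f L by (intro inj_on_concat_equal_length) auto
    then have "enum F = enum G"
      using eq by (rule inj_onD) (use enum F G in auto)
    then show "F = G" using enum F G by (metis PowD)
  qed
  moreover have "length (concat (map f (enum F))) = L * card F" if "F \<subseteq> U" for F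
  proof -
    have "map (length \<circ> f) (enum F) = map (\<lambda>_. L) (enum F)"
      using enum[OF that] f(1) that by (intro map_cong) auto
    then have "length (concat (map f (enum F))) = L * length (enum F)"
      by (simp add: length_concat sum_list_triv mult.commute del: map_eq_conv)
    then show ?thesis using enum[OF that] distinct_card by metis
  qed
  ultimately show ?thesis by blast
qed

definition universe :: "nat \<Rightarrow> nat \<Rightarrow> fact set" where
  "universe k n = {..<k} \<times> {1..n} \<times> {1..n}"

text \<open>\<open>k * n\<^sup>2\<close> is the size of \<open>universe k n\<close>. The
  \<open>Suc\<close> keeps code words nonempty even if there is at most one possible fact.\<close>

definition fact_bits :: "nat \<Rightarrow> nat \<Rightarrow> nat" where
  "fact_bits k n = Suc (LEAST L. k * n\<^sup>2 \<le> 2 ^ L)"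

definition encode :: "nat \<Rightarrow> nat \<Rightarrow> fact set \<Rightarrow> bool list" where
  "encode k n = (SOME code. inj_on code (Pow (universe k n)) \<and>
     (\<forall>F\<subseteq>universe k n. length (code F) = fact_bits k n * card F))"

definition decode :: "nat \<Rightarrow> nat \<Rightarrow> bool list \<Rightarrow> fact set" where
  "decode k n = inv_into (Pow (universe k n)) (encode k n)"

lemma finite_universe: "finite (universe k n)"
  by (simp add: universe_def)

lemma encode_props:
  "inj_on (encode k n) (Pow (universe k n)) \<and>
     (\<forall>F\<subseteq>universe k n. length (encode k n F) = fact_bits k n * card F)"
proof -
  have "k * n\<^sup>2 \<le> 2 ^ (LEAST L. k * n\<^sup>2 \<le> 2 ^ L)"
    by (rule LeastI[of _ "k * n\<^sup>2"]) (simp add: less_imp_le)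
  then have "card (universe k n) \<le> 2 ^ fact_bits k n"
    by (simp add: universe_def fact_bits_def power2_eq_square)
  then have "\<exists>code :: fact set \<Rightarrow> bool list. inj_on code (Pow (universe k n)) \<and>
     (\<forall>F\<subseteq>universe k n. length (code F) = fact_bits k n * card F)"
    using ex_set_code[OF finite_universe, of k n "fact_bits k n"] by (simp add: fact_bits_def)
  then show ?thesis unfolding encode_def by (rule someI_ex)
qed

lemma length_encode: "F \<subseteq> universe k n \<Longrightarrow> length (encode k n F) = fact_bits k n * card F"
  using encode_props by blast

lemma decode_encode: "F \<subseteq> universe k n \<Longrightarrow> decode k n (encode k n F) = F"
  using encode_props unfolding decode_def by (intro inv_into_f_f) auto

text \<open>By minimality of the exponent, \<open>2 ^ l\<close> for its predecessor \<open>l\<close>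
  is below \<open>k * n\<^sup>2\<close>. Bounding \<open>k\<close> by \<open>n ^ k\<close> turns the
  constant \<open>k\<close> into a multiple of \<open>log 2 n\<close> as well.\<close>

lemma fact_bits_le:
  assumes "n \<ge> 2"
  shows "real (fact_bits k n) \<le> (real k + 4) * log 2 n"
proof -
  define L where "L = (LEAST L. k * n\<^sup>2 \<le> 2 ^ L)"
  have log: "log 2 n \<ge> 1" using assms by simp
  have "real L \<le> (real k + 3) * log 2 n"
  proof (cases L)
    case 0
    then show ?thesis using log by simp
  next
    case (Suc l)
    then have "\<not> k * n\<^sup>2 \<le> 2 ^ l"
      using not_less_Least[of l "\<lambda>L. k * n\<^sup>2 \<le> 2 ^ L"] by (simp add: L_def[symmetric])
    then have "2 ^ l \<le> k * n\<^sup>2" by simp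
    also have "k \<le> n ^ k"
      using assms by (meson less_exp less_imp_le order_trans power_mono zero_le)
    finally have "2 ^ l \<le> n ^ (k + 2)" by (simp add: power_add power2_eq_square mult_ac)
    then have "real (2 ^ l) \<le> real (n ^ (k + 2))" by (simp only: of_nat_le_iff)
    then have "real 2 ^ l \<le> real n ^ (k + 2)"
      by (simp only: of_nat_power)
    then have "log 2 (real 2 ^ l) \<le> log 2 (real n ^ (k + 2))"
      using assms by (subst log_le_cancel_iff) auto
    then have "real l \<le> (real k + 2) * log 2 n"
      using assms by (simp only: log_nat_power of_nat_0_less_iff) (simp add: add.commute)
    then show ?thesis using log Suc by (simp add: algebra_simps)
  qed
  then show ?thesis using log by (simp add: fact_bits_def L_def[symmetric] algebra_simps)
qed

subsection \<open>The two-round algorithm\<close>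

datatype weight = Heavy | Medium | Light

lemma finite_UNIV_weight [simp]: "finite (UNIV :: weight set)" and card_UNIV_weight: "CARD(weight) = 3"
proof -
  have UNIV_weight: "(UNIV :: weight set) = {Heavy, Medium, Light}"
    using weight.exhaust by auto
  show "finite (UNIV :: weight set)" "CARD(weight) = 3" by (simp_all add: UNIV_weight)
qed

type_synonym cell = "(nat \<Rightarrow> weight) \<times> (nat \<Rightarrow> nat \<times> nat)"

text \<open>The index is a variable, a number of buckets and a value: one random function supplies a
  separate hash function for every variable and every number of buckets.\<close>

type_synonym hash = "nat \<times> nat \<times> nat \<Rightarrow> nat"

locale cycle_algorithm =
  fixes k p n :: nat
begin

definition nxt :: "nat \<Rightarrow> nat" where "nxt i = (i + 1) mod k"

definition prv :: "nat \<Rightarrow> nat" where "prv i = (i + (k - 1)) mod k"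

definition side :: nat where "side = nat \<lceil>real p powr (1 / real k)\<rceil>"

text \<open>The entry at \<open>(None, None)\<close> is the size \<open>m\<close>, and degrees below \<open>m / p\<close> are recorded as 0.\<close>

definition weight_of :: "statistics \<Rightarrow> nat \<Rightarrow> nat \<Rightarrow> weight" where
  "weight_of st i a =
     (if st 0 (None, None) \<le> side * st i (Some a, None) \<or>
         st 0 (None, None) \<le> side * st (prv i) (None, Some a) then Heavy
      else if st i (Some a, None) = 0 \<and> st (prv i) (None, Some a) = 0 then Light
      else Medium)"

definition isolated :: "(nat \<Rightarrow> weight) \<Rightarrow> nat \<Rightarrow> bool" where
  "isolated \<tau> i \<longleftrightarrow> \<tau> i \<noteq> Heavy \<and> \<tau> (prv i) = Heavy \<and> \<tau> (nxt i) = Heavy"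

definition paired :: "(nat \<Rightarrow> weight) \<Rightarrow> nat \<Rightarrow> bool" where
  "paired \<tau> i \<longleftrightarrow> \<tau> i \<noteq> Heavy \<and> \<tau> (nxt i) \<noteq> Heavy \<and> \<tau> (prv i) = Heavy \<and> \<tau> (nxt (nxt i)) = Heavy"

text \<open>The 1 makes up for rounding down, and gives one bucket to values whose degree is too
  small to be in the statistics.\<close>

definition fan :: "statistics \<Rightarrow> nat \<Rightarrow> nat \<Rightarrow> nat" where
  "fan st i h = 1 + side\<^sup>2 * st i (None, Some h) div st 0 (None, None)"

text \<open>A cell fixes the weight and a coordinate of every variable.  The coordinate of a heavy
  variable is its value, together with the bucket of the preceding variable if that one is
  isolated (which then has no coordinate of its own); all other coordinates are buckets.\<close>

definition coords :: "statistics \<Rightarrow> (nat \<Rightarrow> weight) \<Rightarrow> nat \<Rightarrow> (nat \<times> nat) set" where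
  "coords st \<tau> i =
     (if \<tau> i = Heavy then
        (SIGMA h:{a \<in> {1..n}. weight_of st i a = Heavy}.
           {..<if isolated \<tau> (prv i) then fan st (prv i) h else 1})
      else if isolated \<tau> i then {(0, 0)}
      else {..<side} \<times> {0})"

definition cells :: "statistics \<Rightarrow> cell set" where
  "cells st = (SIGMA \<tau>:{..<k} \<rightarrow>\<^sub>E UNIV. PiE {..<k} (coords st \<tau>))"

text \<open>The two non-heavy variables between two heavy ones share \<open>side\<^sup>2\<close> buckets, according to
  the hash value of one of them that is light, if there is one.\<close>

definition fits :: "statistics \<Rightarrow> hash \<Rightarrow> cell \<Rightarrow> nat \<Rightarrow> nat \<Rightarrow> bool" where
  "fits st g c i a \<longleftrightarrow> (case c of (\<tau>, y) \<Rightarrow>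
     weight_of st i a = \<tau> i \<and>
     (if \<tau> i = Heavy then a = fst (y i)
      else if isolated \<tau> i then g (i, fan st i (fst (y (nxt i))), a) = snd (y (nxt i))
      else if paired \<tau> i then
        \<tau> (nxt i) = Light \<or> g (i, side\<^sup>2, a) = fst (y i) + side * fst (y (nxt i))
      else if paired \<tau> (prv i) then
        \<tau> i = Light \<longrightarrow> g (i, side\<^sup>2, a) = fst (y (prv i)) + side * fst (y i)
      else g (i, side, a) = fst (y i)))"

text \<open>Numbering the finitely many cells and reducing modulo \<open>p\<close> deals them out
  evenly to the servers.\<close>

definition server_of :: "statistics \<Rightarrow> cell \<Rightarrow> nat" where
  "server_of st c = to_nat_on (cells st) c mod p"

definition round1 :: "statistics \<Rightarrow> hash \<Rightarrow> nat \<Rightarrow> fact set" where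
  "round1 st g s = {(i, a, b).
     weight_of st i a \<noteq> Light \<and> weight_of st (nxt i) b \<noteq> Light \<or>
     weight_of st i a = Light \<and> g (i, p, a) = s \<or>
     weight_of st (nxt i) b = Light \<and> g (nxt i, p, b) = s}"

text \<open>After the first round, the server responsible for a light value of a variable knows
  all facts containing it, so it can drop the facts that have no partner in the cell.\<close>

definition forward :: "statistics \<Rightarrow> hash \<Rightarrow> fact set \<Rightarrow> nat \<Rightarrow> cell \<Rightarrow> fact set" where
  "forward st g K t c = {(i, a, b) \<in> K. fits st g c i a \<and> fits st g c (nxt i) b \<and>
     (weight_of st i a = Light \<and> g (i, p, a) = t \<and>
        (\<exists>a'. (prv i, a', a) \<in> K \<and> fits st g c (prv i) a') \<or>
      weight_of st (nxt i) b = Light \<and> g (nxt i, p, b) = t \<and>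
        (\<exists>b'. (nxt i, b, b') \<in> K \<and> fits st g c (nxt (nxt i)) b'))}"

definition round2 :: "statistics \<Rightarrow> hash \<Rightarrow> fact set \<Rightarrow> nat \<Rightarrow> nat \<Rightarrow> fact set" where
  "round2 st g K t s = (\<Union>c\<in>{c \<in> cells st. server_of st c = s}. forward st g K t c)"

text \<open>The range of the middle component covers all bucket numbers in use: \<open>p\<close>,
  \<open>side\<close>, \<open>side\<^sup>2\<close> and every value of \<open>fan\<close>.\<close>

definition hash_index :: "(nat \<times> nat \<times> nat) set" where
  "hash_index = {..<k} \<times> {1..p + side\<^sup>2 + 1} \<times> {1..n}"

definition hash_pmf :: "hash pmf" where
  "hash_pmf = Pi_pmf hash_index 0 (\<lambda>(i, q, a). pmf_of_set {..<q})"

text \<open>Seeds are natural numbers, so a hash function is drawn as its number in the countable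
  support; this undoes the numbering in \<open>alg\<close>.\<close>

definition hash_of :: "nat \<Rightarrow> hash" where
  "hash_of = from_nat_into (set_pmf hash_pmf)"

definition learned :: "server_view \<Rightarrow> nat \<Rightarrow> fact set" where
  "learned v r = (\<Union>t<p. decode k n ((received v ! r) t))"

text \<open>\<open>received\<close> grows by one entry per round, even if all strings in it are
  empty, so testing it for \<open>[]\<close> tells the first round from the second.\<close>

definition alg :: mpc_algorithm where
  "alg = \<lparr>num_rounds = 2,
     seed_dist = map_pmf (to_nat_on (set_pmf hash_pmf)) hash_pmf,
     message = (\<lambda>v s. encode k n
        (if received v = [] then local_input v \<inter> round1 (stats v) (hash_of (seed v)) s
         else round2 (stats v) (hash_of (seed v)) (learned v 0) (self v) s)),
     local_output = (\<lambda>v. {x. length x = k \<and>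
        (\<forall>j<k. (j, x ! j, x ! nxt j) \<in> learned v 0 \<union> learned v 1)})\<rparr>"

end

text \<open>The exponent 5 makes \<open>m / side\<^sup>2\<close> at least \<open>p ^ 3\<close>. This
  dominates the \<open>O(p ^ 2)\<close> broadcast facts and makes the tail terms
  \<open>exp (- quota)\<close> small.\<close>

locale cycle_input = cycle_algorithm +
  fixes m :: nat and S :: db and D :: "nat \<Rightarrow> fact set"
  assumes k: "k \<ge> 3" and p: "p \<ge> 1" and m: "real m \<ge> real p ^ 5"
    and input: "is_input (cycle_query k) n m S"
    and part: "even_partition p (cycle_query k) S D"
begin

abbreviation "st \<equiv> data_statistics p (cycle_query k) S"

abbreviation "F \<equiv> facts (cycle_query k) S"

lemma nxt_less [simp]: "nxt i < k" and prv_less [simp]: "prv i < k"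
  using k by (auto simp: nxt_def prv_def)

lemma nxt_prv [simp]: "i < k \<Longrightarrow> nxt (prv i) = i"
  using k by (simp add: nxt_def prv_def mod_simps)

lemma prv_nxt [simp]: "i < k \<Longrightarrow> prv (nxt i) = i"
  using k by (cases "i + 1 = k") (auto simp: nxt_def prv_def)

lemma nxt_neq: "i < k \<Longrightarrow> nxt i \<noteq> i"
  using k by (auto simp: nxt_def mod_Suc)

lemma length_query [simp]: "length (cycle_query k) = k"
  by (simp add: cycle_query_def)

lemma nth_query: "j < k \<Longrightarrow> cycle_query k ! j = (j, nxt j)"
  by (simp add: cycle_query_def nxt_def)

lemma mem_facts: "(i, a, b) \<in> F \<longleftrightarrow> i < k \<and> (a, b) \<in> S i"
  by (simp add: facts_def)

lemma S_subset: "i < k \<Longrightarrow> S i \<subseteq> {1..n} \<times> {1..n}"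
  and card_S: "i < k \<Longrightarrow> card (S i) = m"
  using input by (simp_all add: is_input_def)

lemma facts_universe: "F \<subseteq> universe k n"
  using S_subset by (fastforce simp: universe_def facts_def)

lemma Union_D: "(\<Union>t<p. D t) = F" and disjoint_D: "disjoint_family_on D {..<p}"
  using part by (simp_all add: even_partition_def)

lemma m_pos: "m > 0"
proof -
  have "real p ^ 5 \<ge> 1" using p by simp
  then show ?thesis using m by linarith
qed

lemma side_pos: "side > 0"
  using p by (simp add: side_def)

lemma round2_subset: "round2 st' g K t s \<subseteq> K"
  by (auto simp: round2_def forward_def)

section \<open>Execution of the algorithm: knowledge, output and bits received\<close>

definition known1 :: "hash \<Rightarrow> nat \<Rightarrow> fact set" where "known1 g s = F \<inter> round1 st g s"

definition known2 :: "hash \<Rightarrow> nat \<Rightarrow> fact set" where "known2 g s = (\<Union>t<p. round2 st g (known1 g t) t s)"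

abbreviation "run \<omega> \<equiv> view_after alg p st D \<omega>"

lemma num_rounds_alg [simp]: "num_rounds alg = 2"
  by (simp add: alg_def)

lemma message_0:
  "message alg (run \<omega> 0 t) s = encode k n (D t \<inter> round1 st (hash_of \<omega>) s)"
  by (simp add: alg_def)

text \<open>Later rounds only append to \<open>received\<close>, so its first entry keeps the value
  it has after round one.\<close>

lemma learned_0: "r > 0 \<Longrightarrow> learned (run \<omega> r s) 0 = known1 (hash_of \<omega>) s"
proof (induction r)
  case (Suc r)
  show ?case
  proof (cases r)
    case 0
    have "learned (run \<omega> (Suc 0) s) 0 = (\<Union>t<p. decode k n (message alg (run \<omega> 0 t) s))"
      by (simp add: learned_def)
    also have "\<dots> = (\<Union>t<p. D t \<inter> round1 st (hash_of \<omega>) s)"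
      unfolding message_0 using Union_D facts_universe
      by (intro SUP_cong) (auto intro!: decode_encode)
    finally show ?thesis using 0 Union_D by (auto simp: known1_def)
  next
    case (Suc r')
    have "length (received (run \<omega> r s)) = r" for r s by (induction r) simp_all
    then have "(received (run \<omega> (Suc r) s)) ! 0 = received (run \<omega> r s) ! 0"
      using Suc by (simp add: nth_append del: view_after.simps(2)) (simp add: nth_append)
    then show ?thesis using Suc Suc.IH by (simp only: learned_def)
  qed
qed simp

lemma message_1:
  "message alg (run \<omega> 1 t) s = encode k n (round2 st (hash_of \<omega>) (known1 (hash_of \<omega>) t) t s)"
proof -
  have "received (run \<omega> 1 t) \<noteq> []" "stats (run \<omega> 1 t) = st" "seed (run \<omega> 1 t) = \<omega>" "self (run \<omega> 1 t) = t"
    by simp_all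
  then show ?thesis using learned_0[of 1 \<omega> t] by (simp add: alg_def del: One_nat_def)
qed

lemma learned_1: "learned (run \<omega> 2 s) 1 = known2 (hash_of \<omega>) s"
proof -
  have "run \<omega> 2 s = run \<omega> (Suc 1) s" by (simp only: Suc_1)
  then have "learned (run \<omega> 2 s) 1 = (\<Union>t<p. decode k n (message alg (run \<omega> 1 t) s))"
    by (simp add: learned_def)
  also have "\<dots> = known2 (hash_of \<omega>) s"
    unfolding message_1 known2_def using facts_universe round2_subset
    by (intro SUP_cong decode_encode) (fastforce simp: known1_def)+
  finally show ?thesis .
qed

lemma output_eq: "mpc_output alg p st D \<omega> =
   (\<Union>s<p. {x. length x = k \<and> (\<forall>j<k. (j, x ! j, x ! nxt j) \<in> known1 (hash_of \<omega>) s \<union> known2 (hash_of \<omega>) s)})"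
proof -
  have "local_output alg v = {x. length x = k \<and> (\<forall>j<k. (j, x ! j, x ! nxt j) \<in> learned v 0 \<union> learned v 1)}"
    "num_rounds alg = 2" for v
    by (simp_all add: alg_def)
  then show ?thesis unfolding mpc_output_def by (simp only: learned_1 learned_0[OF zero_less_numeral])
qed

lemma bits_received_0:
  "bits_received alg p st D \<omega> 0 s = fact_bits k n * (\<Sum>t<p. card (D t \<inter> round1 st (hash_of \<omega>) s))"
proof -
  have "bits_received alg p st D \<omega> 0 s = (\<Sum>t<p. fact_bits k n * card (D t \<inter> round1 st (hash_of \<omega>) s))"
    unfolding bits_received_def message_0 using Union_D facts_universe
    by (intro sum.cong refl length_encode) auto
  then show ?thesis by (simp add: sum_distrib_left)
qed

lemma bits_received_1:
  "bits_received alg p st D \<omega> 1 s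
     = fact_bits k n * (\<Sum>t<p. card (round2 st (hash_of \<omega>) (known1 (hash_of \<omega>) t) t s))"
proof -
  have "bits_received alg p st D \<omega> 1 s
      = (\<Sum>t<p. fact_bits k n * card (round2 st (hash_of \<omega>) (known1 (hash_of \<omega>) t) t s))"
    unfolding bits_received_def message_1 using facts_universe round2_subset
    by (intro sum.cong refl length_encode) (fastforce simp: known1_def)
  then show ?thesis by (simp add: sum_distrib_left)
qed

text \<open>Every transmitted fact costs exactly \<open>fact_bits k n\<close> bits, so it suffices
  to count facts. \<open>B \<ge> 0\<close> takes care of the 0 inserted into the maximum.\<close>

lemma load_le:
  fixes B :: real
  assumes "\<And>s. s < p \<Longrightarrow> real (\<Sum>t<p. card (D t \<inter> round1 st (hash_of \<omega>) s)) \<le> B"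
    and "\<And>s. s < p \<Longrightarrow> real (\<Sum>t<p. card (round2 st (hash_of \<omega>) (known1 (hash_of \<omega>) t) t s)) \<le> B"
    and "B \<ge> 0"
  shows "real (load alg p st D \<omega>) \<le> fact_bits k n * B"
proof -
  let ?X = "{bits_received alg p st D \<omega> r s | r s. r < num_rounds alg \<and> s < p}"
  have "?X = (\<lambda>(r, s). bits_received alg p st D \<omega> r s) ` ({..<2} \<times> {..<p})"
    by auto
  then have fin: "finite ?X" by simp
  have "real x \<le> fact_bits k n * B" if x: "x \<in> insert 0 ?X" for x
  proof (cases "x = 0")
    case False
    then obtain r s where rs: "x = bits_received alg p st D \<omega> r s" "r < 2" "s < p"
      using x by auto
    then consider "r = 0" | "r = 1" by linarith
    then show ?thesis
    proof cases
      case 1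
      then show ?thesis unfolding rs(1) using assms(1)[OF rs(3)]
        by (simp only: bits_received_0 of_nat_mult) (simp add: mult_left_mono)
    next
      case 2
      then show ?thesis unfolding rs(1) using assms(2)[OF rs(3)]
        by (simp only: bits_received_1 of_nat_mult) (simp add: mult_left_mono)
    qed
  qed (use assms(3) in simp)
  moreover have "load alg p st D \<omega> \<in> insert 0 ?X"
    unfolding load_def using fin by (intro Max_in) auto
  ultimately show ?thesis by blast
qed

subsection \<open>Correctness\<close>

lemma finite_hash_index [simp]: "finite hash_index"
  by (simp add: hash_index_def)

text \<open>On \<open>hash_index\<close> the value is drawn from \<open>{..<q}\<close>; elsewhere it
  is the default 0, which is below \<open>q\<close> too.\<close>

lemma hash_less:
  assumes "g \<in> set_pmf hash_pmf" "q > 0"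
  shows "g (i, q, a) < q"
proof -
  have g: "g \<in> PiE_dflt hash_index 0 (set_pmf \<circ> (\<lambda>(i, q, a). pmf_of_set {..<q}))"
    using assms(1) unfolding hash_pmf_def by (rule subsetD[OF set_Pi_pmf_subset'[OF finite_hash_index]])
  show ?thesis
  proof (cases "(i, q, a) \<in> hash_index")
    case True
    then have "g (i, q, a) \<in> set_pmf (pmf_of_set {..<q})"
      using g by (auto simp: PiE_dflt_def)
    then show ?thesis using assms by (simp add: lessThan_empty_iff)
  next
    case False
    then show ?thesis using g assms(2) by (simp add: PiE_dflt_def)
  qed
qed

definition types :: "nat list \<Rightarrow> nat \<Rightarrow> weight" where
  "types x = (\<lambda>i\<in>{..<k}. weight_of st i (x ! i))"

definition pair_bucket :: "hash \<Rightarrow> nat list \<Rightarrow> nat \<Rightarrow> nat" where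
  "pair_bucket g x i = (if types x (nxt i) = Light then g (nxt i, side\<^sup>2, x ! nxt i) else g (i, side\<^sup>2, x ! i))"

text \<open>Together with \<open>types x\<close> this is the cell of the answer \<open>x\<close>.
  The bucket shared by a pair is a number below \<open>side\<^sup>2\<close>; its two digits in base
  \<open>side\<close> become the coordinates of the two variables.\<close>

definition position :: "hash \<Rightarrow> nat list \<Rightarrow> nat \<Rightarrow> nat \<times> nat" where
  "position g x = (\<lambda>i\<in>{..<k}.
     if types x i = Heavy then
       (x ! i, if isolated (types x) (prv i) then g (prv i, fan st (prv i) (x ! i), x ! prv i) else 0)
     else if isolated (types x) i then (0, 0)
     else if paired (types x) i then (pair_bucket g x i mod side, 0)
     else if paired (types x) (prv i) then (pair_bucket g x (prv i) div side, 0)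
     else (g (i, side, x ! i), 0))"

lemma fits_position:
  assumes i: "i < k"
  shows "fits st g (types x, position g x) i (x ! i)"
proof -
  note d = position_def fits_def i
  have w: "weight_of st i (x ! i) = types x i" using i by (simp add: types_def)
  consider "types x i = Heavy" | "types x i \<noteq> Heavy" "isolated (types x) i"
    | "types x i \<noteq> Heavy" "\<not> isolated (types x) i" "paired (types x) i"
    | "types x i \<noteq> Heavy" "\<not> isolated (types x) i" "\<not> paired (types x) i" "paired (types x) (prv i)"
    | "types x i \<noteq> Heavy" "\<not> isolated (types x) i" "\<not> paired (types x) i" "\<not> paired (types x) (prv i)"
    by blast
  then show ?thesis
  proof cases
    case 1
    then show ?thesis using w by (simp add: d)
  next
    case 2
    then have "types x (nxt i) = Heavy" by (simp add: isolated_def)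
    then show ?thesis using 2 w by (simp add: d)
  next
    case 3
    \<comment> \<open>Hence \<open>position\<close> takes the quotient branch at
      \<open>nxt i\<close>, and the two digits recombine to the shared bucket.\<close>
    then have n: "types x (nxt i) \<noteq> Heavy" "\<not> isolated (types x) (nxt i)" "\<not> paired (types x) (nxt i)"
      using i by (auto simp: isolated_def paired_def)
    then show ?thesis using 3 w by (simp add: d) (simp add: pair_bucket_def)
  next
    case 4
    then have n: "types x (prv i) \<noteq> Heavy" "\<not> isolated (types x) (prv i)"
      using i by (auto simp: isolated_def paired_def)
    then show ?thesis using 4 w nxt_prv[OF i] by (simp add: d) (simp add: pair_bucket_def i)
  next
    case 5
    then show ?thesis using w by (simp add: d)
  qed
qed

lemma position_in_cells:
  assumes x: "\<And>i. i < k \<Longrightarrow> x ! i \<in> {1..n}" and g: "g \<in> set_pmf hash_pmf"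
  shows "(types x, position g x) \<in> cells st"
proof -
  have fan: "fan st i h > 0" for i h by (simp add: fan_def)
  have pb: "pair_bucket g x i < side * side" for i
    using hash_less[OF g, of "side\<^sup>2"] side_pos by (auto simp: pair_bucket_def power2_eq_square)
  have "position g x i \<in> coords st (types x) i" if i: "i < k" for i
  proof -
    have "types x i = weight_of st i (x ! i)" using i by (simp add: types_def)
    then show ?thesis
      using i x[OF i] hash_less[OF g fan] hash_less[OF g side_pos] side_pos pb
      by (auto simp: position_def coords_def less_mult_imp_div_less)
  qed
  then show ?thesis
    by (auto simp: cells_def types_def position_def intro!: PiE_I)
qed

text \<open>Servers only know facts of the input, so nothing wrong is output. An answer is found by
  the server of its own cell: its facts without light values are broadcast, and every other one
  reaches that server from the server of one of its light values.\<close>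

lemma output_correct:
  assumes "\<omega> \<in> set_pmf (seed_dist alg)"
  shows "mpc_output alg p st D \<omega> = answers k (cycle_query k) S"
proof -
  obtain g where g: "g \<in> set_pmf hash_pmf" and \<omega>: "hash_of \<omega> = g"
    using assms by (auto simp: alg_def hash_of_def)
  have sub: "known1 g s \<subseteq> F" "known2 g s \<subseteq> F" for s
    using round2_subset by (fastforce simp: known1_def known2_def)+
  have ans: "answers k (cycle_query k) S = {x. length x = k \<and> (\<forall>j<k. (j, x ! j, x ! nxt j) \<in> F)}"
    by (auto simp: answers_def nth_query mem_facts)
  have "\<exists>s<p. \<forall>j<k. (j, x ! j, x ! nxt j) \<in> known1 g s \<union> known2 g s"
    if x: "\<And>j. j < k \<Longrightarrow> (j, x ! j, x ! nxt j) \<in> F" for x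
  proof -
    let ?c = "(types x, position g x)"
    define s where "s = server_of st ?c"
    have "x ! j \<in> {1..n}" if "j < k" for j
      using x[OF that] S_subset[OF that] by (auto simp: mem_facts)
    then have c: "?c \<in> cells st" using g by (rule position_in_cells)
    note fit = fits_position[of _ g x]
    have K1I: "(j, x ! j, x ! nxt j) \<in> known1 g t"
      if "j < k" "weight_of st j (x ! j) = Light \<and> g (j, p, x ! j) = t \<or>
          weight_of st (nxt j) (x ! nxt j) = Light \<and> g (nxt j, p, x ! nxt j) = t" for j t
      using x[OF that(1)] that(2) by (auto simp: known1_def round1_def)
    have K2I: "(j, x ! j, x ! nxt j) \<in> known2 g s"
      if "t < p" "(j, x ! j, x ! nxt j) \<in> forward st g (known1 g t) t ?c" for j t
      using that c by (auto simp: known2_def round2_def s_def)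
    have "(j, x ! j, x ! nxt j) \<in> known1 g s \<union> known2 g s" if j: "j < k" for j
    proof -
      consider "weight_of st j (x ! j) = Light" | "weight_of st (nxt j) (x ! nxt j) = Light"
        | "weight_of st j (x ! j) \<noteq> Light" "weight_of st (nxt j) (x ! nxt j) \<noteq> Light" by blast
      then show ?thesis
      proof cases
        case 1
        have t: "g (j, p, x ! j) < p" using hash_less[OF g] p by simp
        \<comment> \<open>The preceding fact of the answer contains the same light value, so the
          same server knows it and the fact is not dangling.\<close>
        moreover have "(prv j, x ! prv j, x ! j) \<in> known1 g (g (j, p, x ! j))"
          using K1I[of "prv j"] 1 j by simp
        ultimately show ?thesis
          using 1 j fit[of j] fit[of "nxt j"] fit[of "prv j"] K1I[of j]
          by (intro UnI2 K2I[OF t]) (auto simp: forward_def)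
      next
        case 2
        have t: "g (nxt j, p, x ! nxt j) < p" using hash_less[OF g] p by simp
        moreover have "(nxt j, x ! nxt j, x ! nxt (nxt j)) \<in> known1 g (g (nxt j, p, x ! nxt j))"
          using K1I[of "nxt j"] 2 j by simp
        ultimately show ?thesis
          using 2 j fit[of j] fit[of "nxt j"] fit[of "nxt (nxt j)"] K1I[of j]
          by (intro UnI2 K2I[OF t]) (auto simp: forward_def)
      next
        case 3
        then show ?thesis using x[OF j] by (auto simp: known1_def round1_def)
      qed
    qed
    moreover have "s < p" using p by (simp add: s_def server_of_def)
    ultimately show ?thesis by blast
  qed
  note complete = this
  show ?thesis
    unfolding output_eq \<omega> ans
  proof (intro equalityI subsetI)
    fix x assume "x \<in> (\<Union>s<p. {x. length x = k \<and> (\<forall>j<k. (j, x ! j, x ! nxt j) \<in> known1 g s \<union> known2 g s)})"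
    then show "x \<in> {x. length x = k \<and> (\<forall>j<k. (j, x ! j, x ! nxt j) \<in> F)}"
      using sub by fast
  next
    fix x assume "x \<in> {x. length x = k \<and> (\<forall>j<k. (j, x ! j, x ! nxt j) \<in> F)}"
    then show "x \<in> (\<Union>s<p. {x. length x = k \<and> (\<forall>j<k. (j, x ! j, x ! nxt j) \<in> known1 g s \<union> known2 g s)})"
      using complete[of x] by (simp add: Bex_def)
  qed
qed

subsection \<open>Degrees and the number of cells\<close>

definition outdeg :: "nat \<Rightarrow> nat \<Rightarrow> nat" where "outdeg i a = card {b. (a, b) \<in> S i}"

definition indeg :: "nat \<Rightarrow> nat \<Rightarrow> nat" where "indeg i b = card {a. (a, b) \<in> S i}"

lemma finite_S: "i < k \<Longrightarrow> finite (S i)"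
  using S_subset finite_subset by blast

lemma freq_out: "freq (S i) (Some a, None) = outdeg i a"
  unfolding freq_def outdeg_def
  by (rule bij_betw_same_card[of snd]) (auto simp: bij_betw_def inj_on_def image_iff)

lemma freq_in: "freq (S i) (None, Some b) = indeg i b"
  unfolding freq_def indeg_def
  by (rule bij_betw_same_card[of fst]) (auto simp: bij_betw_def inj_on_def image_iff)

lemma stat_size: "st 0 (None, None) = m"
proof -
  have "freq (S 0) (None, None) = m" using card_S[of 0] k by (simp add: freq_def)
  then show ?thesis using k p card_S[of 0]
    by (simp add: data_statistics_def divide_le_eq mult_le_cancel_left1)
qed

lemma stat_out: "i < k \<Longrightarrow> st i (Some a, None) = (if m \<le> p * outdeg i a then outdeg i a else 0)"
  and stat_in: "i < k \<Longrightarrow> st i (None, Some a) = (if m \<le> p * indeg i a then indeg i a else 0)"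
proof -
  have "real m / real p \<le> real d \<longleftrightarrow> m \<le> p * d" for d
  proof -
    have "real m / real p \<le> real d \<longleftrightarrow> real m \<le> real (p * d)" using p by (simp add: divide_le_eq mult.commute)
    then show ?thesis by (simp only: of_nat_le_iff)
  qed
  then show "i < k \<Longrightarrow> st i (Some a, None) = (if m \<le> p * outdeg i a then outdeg i a else 0)"
    "i < k \<Longrightarrow> st i (None, Some a) = (if m \<le> p * indeg i a then indeg i a else 0)"
    by (simp_all add: data_statistics_def freq_out freq_in card_S)
qed

lemma side_le_p: "side \<le> p"
proof -
  have "real p powr (1 / real k) \<le> real p powr 1" using k p by (intro powr_mono) auto
  then show ?thesis using p by (simp add: side_def ceiling_le_iff)
qed

text \<open>Rounding up a number that is at least 1 at most doubles it.\<close>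

lemma side_le_root: "real side \<le> 2 * real p powr (1 / real k)"
proof -
  have "real p powr (1 / real k) \<ge> 1" using p k by (intro ge_one_powr_ge_zero) auto
  then show ?thesis unfolding side_def by linarith
qed

lemma side_square_le: "real side ^ 2 \<le> 4 * real p powr (2 / real k)"
proof -
  have "real side ^ 2 \<le> (2 * real p powr (1 / real k)) ^ 2"
    using side_le_root by (intro power_mono) auto
  also have "\<dots> = 4 * real p powr (2 / real k)"
    using p by (simp add: power_mult_distrib powr_powr flip: powr_numeral)
  finally show ?thesis .
qed

lemma side_square_le_p: "side\<^sup>2 \<le> 4 * p"
proof -
  have "real p powr (2 / real k) \<le> real p powr 1" using k p by (intro powr_mono) auto
  then have "real (side\<^sup>2) \<le> real (4 * p)" using side_square_le p by simp
  then show ?thesis by (simp only: of_nat_le_iff)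
qed

lemma side_power_le: "side ^ k \<le> 2 ^ k * p"
proof -
  have "real side ^ k \<le> (2 * real p powr (1 / real k)) ^ k"
    using side_le_root by (intro power_mono) auto
  also have "\<dots> = 2 ^ k * real p"
    using p k by (simp add: power_mult_distrib powr_powr flip: powr_realpow)
  finally have "real (side ^ k) \<le> real (2 ^ k * p)" by simp
  then show ?thesis by (simp only: of_nat_le_iff)
qed

text \<open>A degree missing from the statistics is below \<open>m / p\<close>, which is at most
  \<open>m / side\<close>.\<close>

lemma not_heavy:
  assumes "i < k" "weight_of st i a \<noteq> Heavy"
  shows "side * outdeg i a \<le> m" "side * indeg (prv i) a \<le> m"
proof -
  have "side * d \<le> m" if "\<not> m \<le> side * (if m \<le> p * d then d else 0)" for d
  proof (cases "m \<le> p * d")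
    case False
    moreover have "side * d \<le> p * d" using side_le_p by simp
    ultimately show ?thesis by linarith
  qed (use that in simp)
  then show "side * outdeg i a \<le> m" "side * indeg (prv i) a \<le> m"
    using assms stat_out[of i a] stat_in[of "prv i" a]
    by (auto simp: weight_of_def stat_size simp del: not_le split: if_splits)
qed

lemma light:
  assumes "i < k" "weight_of st i a = Light"
  shows "p * outdeg i a \<le> m" "p * indeg (prv i) a \<le> m"
  using assms m_pos stat_out[of i a] stat_in[of "prv i" a]
  by (auto simp: weight_of_def stat_size split: if_splits)

text \<open>Each of the two relations of the variable contributes at most \<open>side\<close>
  frequent values; the converse turns in-degrees into row sizes.\<close>

lemma card_heavy: "i < k \<Longrightarrow> card {a \<in> {1..n}. weight_of st i a = Heavy} \<le> 2 * side"
proof -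
  assume i: "i < k"
  have conv: "card ((S j)\<inverse>) = m" "finite ((S j)\<inverse>)" if "j < k" for j
    using card_S[OF that] finite_S[OF that] by (simp_all add: card_inverse)
  let ?A = "{a \<in> {1..n}. m \<le> side * outdeg i a}" and ?B = "{a \<in> {1..n}. m \<le> side * indeg (prv i) a}"
  have "card ?A \<le> side"
    by (rule card_frequent_le[of "S i"]) (use i finite_S card_S m_pos in \<open>auto simp: outdeg_def\<close>)
  moreover have "card ?B \<le> side"
    by (rule card_frequent_le[of "(S (prv i))\<inverse>"]) (use conv m_pos in \<open>auto simp: indeg_def\<close>)
  moreover have "{a \<in> {1..n}. weight_of st i a = Heavy} \<subseteq> ?A \<union> ?B"
    using m_pos i by (auto simp: weight_of_def stat_size stat_out stat_in split: if_splits)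
  then have "card {a \<in> {1..n}. weight_of st i a = Heavy} \<le> card ?A + card ?B"
    by (intro order_trans[OF card_mono card_Un_le]) auto
  ultimately show ?thesis by linarith
qed

lemma card_not_light: "i < k \<Longrightarrow> card {a \<in> {1..n}. weight_of st i a \<noteq> Light} \<le> 2 * p"
proof -
  assume i: "i < k"
  have conv: "card ((S j)\<inverse>) = m" "finite ((S j)\<inverse>)" if "j < k" for j
    using card_S[OF that] finite_S[OF that] by (simp_all add: card_inverse)
  let ?A = "{a \<in> {1..n}. m \<le> p * outdeg i a}" and ?B = "{a \<in> {1..n}. m \<le> p * indeg (prv i) a}"
  have "card ?A \<le> p"
    by (rule card_frequent_le[of "S i"]) (use i finite_S card_S m_pos in \<open>auto simp: outdeg_def\<close>)
  moreover have "card ?B \<le> p"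
    by (rule card_frequent_le[of "(S (prv i))\<inverse>"]) (use conv m_pos in \<open>auto simp: indeg_def\<close>)
  moreover have "{a \<in> {1..n}. weight_of st i a \<noteq> Light} \<subseteq> ?A \<union> ?B"
    using m_pos i by (auto simp: weight_of_def stat_size stat_out stat_in split: if_splits)
  then have "card {a \<in> {1..n}. weight_of st i a \<noteq> Light} \<le> card ?A + card ?B"
    by (intro order_trans[OF card_mono card_Un_le]) auto
  ultimately show ?thesis by linarith
qed

text \<open>The quotients add up to at most \<open>side\<^sup>2\<close> because the in-degrees add
  up to at most \<open>m\<close>; the ones add the number of heavy values, at most
  \<open>2 * side\<close>.\<close>

lemma sum_fan:
  assumes i: "i < k"
  shows "(\<Sum>h | h \<in> {1..n} \<and> weight_of st (nxt i) h = Heavy. fan st i h) \<le> 3 * side\<^sup>2"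
proof -
  let ?H = "{h \<in> {1..n}. weight_of st (nxt i) h = Heavy}"
  have conv: "card ((S i)\<inverse>) = m" "finite ((S i)\<inverse>)"
    using card_S[OF i] finite_S[OF i] by (simp_all add: card_inverse)
  have "m * (\<Sum>h\<in>?H. side\<^sup>2 * st i (None, Some h) div m) \<le> (\<Sum>h\<in>?H. side\<^sup>2 * indeg i h)"
    unfolding sum_distrib_left
  proof (rule sum_mono)
    fix h
    have "m * (side\<^sup>2 * st i (None, Some h) div m) \<le> side\<^sup>2 * st i (None, Some h)" by simp
    also have "\<dots> \<le> side\<^sup>2 * indeg i h" using stat_in[OF i] by simp
    finally show "m * (side\<^sup>2 * st i (None, Some h) div m) \<le> side\<^sup>2 * indeg i h" .
  qed
  also have "\<dots> = side\<^sup>2 * (\<Sum>h\<in>?H. card {b. (h, b) \<in> (S i)\<inverse>})"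
    by (simp add: sum_distrib_left indeg_def)
  also have "\<dots> \<le> side\<^sup>2 * m"
    using sum_card_rows_le[OF conv(2), of ?H] conv(1) by simp
  finally have "(\<Sum>h\<in>?H. side\<^sup>2 * st i (None, Some h) div m) \<le> side\<^sup>2"
    using m_pos by (simp add: mult.commute)
  moreover have "card ?H \<le> 2 * side\<^sup>2"
    using card_heavy[of "nxt i"] side_pos by (simp add: power2_eq_square) (meson le_trans mult_le_mono2 le_square)
  moreover have "(\<Sum>h\<in>?H. fan st i h) = card ?H + (\<Sum>h\<in>?H. side\<^sup>2 * st i (None, Some h) div m)"
    unfolding fan_def stat_size sum.distrib by simp
  ultimately show ?thesis by linarith
qed

lemma finite_coords: "finite (coords st \<tau> i)"
  by (auto simp: coords_def)

lemma finite_cells: "finite (cells st)"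
  by (auto simp: cells_def intro!: finite_SigmaI finite_PiE finite_coords)

text \<open>The buckets of an isolated variable are counted at its successor; the two correction factors
  cancel in the product around the cycle.\<close>

lemma card_coords:
  assumes i: "i < k"
  shows "card (coords st \<tau> i) * (if isolated \<tau> i then side else 1)
           \<le> 3 * side * (if isolated \<tau> (prv i) then side else 1)"
proof (cases "\<tau> i = Heavy")
  case True
  let ?H = "{a \<in> {1..n}. weight_of st i a = Heavy}"
  have "card (coords st \<tau> i) = (\<Sum>h\<in>?H. if isolated \<tau> (prv i) then fan st (prv i) h else 1)"
    using True by (simp add: coords_def)
  then show ?thesis
    using True card_heavy[OF i] sum_fan[of "prv i"] i
    by (auto simp: isolated_def power2_eq_square)
next
  case False
  then show ?thesis using side_pos by (auto simp: coords_def card_cartesian_product)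
qed

text \<open>Per variable, 18 collects a factor 3 for the choice of a weight, 3 from
  \<open>card_coords\<close>, and 2 for the rounding in \<open>side\<close>.\<close>

lemma card_cells: "card (cells st) \<le> 18 ^ k * p"
proof -
  have "card (PiE {..<k} (coords st \<tau>)) \<le> 3 ^ k * side ^ k" for \<tau>
  proof -
    define r where "r j = (if isolated \<tau> j then side else 1)" for j
    have "card (PiE {..<k} (coords st \<tau>)) * (\<Prod>i<k. r i) = (\<Prod>i<k. card (coords st \<tau> i) * r i)"
      by (simp add: card_PiE prod.distrib)
    also have "\<dots> \<le> (\<Prod>i<k. 3 * side * r (prv i))"
      using card_coords by (intro prod_mono) (auto simp: r_def)
    also have "\<dots> = 3 ^ k * side ^ k * (\<Prod>i<k. r (prv i))"
      by (simp add: prod.distrib power_mult_distrib)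
    also have "(\<Prod>i<k. r (prv i)) = (\<Prod>i<k. r i)"
      by (rule prod.reindex_bij_witness[of _ nxt prv]) auto
    finally show ?thesis using side_pos by (simp add: r_def prod_pos)
  qed
  note card_le = this
  have "card (cells st) = (\<Sum>\<tau>\<in>{..<k} \<rightarrow>\<^sub>E (UNIV :: weight set). card (PiE {..<k} (coords st \<tau>)))"
    unfolding cells_def by (intro card_SigmaI finite_PiE ballI finite_coords) auto
  also have "\<dots> \<le> (\<Sum>\<tau>\<in>{..<k} \<rightarrow>\<^sub>E (UNIV :: weight set). 3 ^ k * side ^ k)"
    by (intro sum_mono card_le)
  also have "\<dots> = 3 ^ k * (3 ^ k * side ^ k)"
    by (simp add: card_PiE card_UNIV_weight)
  also have "\<dots> \<le> 3 ^ k * (3 ^ k * (2 ^ k * p))" using side_power_le by simp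
  also have "\<dots> = 18 ^ k * p" by (simp add: power_mult_distrib[symmetric] mult.assoc[symmetric])
  finally show ?thesis .
qed

lemma card_cells_of_server: "card {c \<in> cells st. server_of st c = s} \<le> 18 ^ k + 1"
proof -
  have bij: "bij_betw (to_nat_on (cells st)) (cells st) {..<card (cells st)}"
    by (rule to_nat_on_finite[OF finite_cells])
  have "card {c \<in> cells st. server_of st c = s} \<le> card {j. j < card (cells st) \<and> j mod p = s}"
  proof (rule card_inj_on_le)
    show "inj_on (to_nat_on (cells st)) {c \<in> cells st. server_of st c = s}"
      using bij by (auto simp: bij_betw_def intro: inj_on_subset)
    show "to_nat_on (cells st) ` {c \<in> cells st. server_of st c = s} \<subseteq> {j. j < card (cells st) \<and> j mod p = s}"
      using bij_betwE[OF bij] by (auto simp: server_of_def)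
  qed simp
  also have "\<dots> \<le> card (cells st) div p + 1" using p by (intro card_mod_class_le) simp
  also have "card (cells st) div p \<le> 18 ^ k" using div_le_mono[OF card_cells, of p] p by simp
  finally show ?thesis by simp
qed

subsection \<open>Load under well-spread hash values\<close>

text \<open>All that the load analysis asks of the hash values. The first clause serves round one
  (\<open>q = p\<close>) and pairs (\<open>q = side\<^sup>2\<close>), the second isolated variables,
  the third the remaining adjacent non-heavy variables.\<close>

definition spread :: "real \<Rightarrow> hash \<Rightarrow> bool" where
  "spread T g \<longleftrightarrow>
     (\<forall>i<k. \<forall>q\<in>{p, side\<^sup>2}. \<forall>c<q.
        real (card {(a, b) \<in> S i. weight_of st i a = Light \<and> g (i, q, a) = c}) \<le> T \<and>
        real (card {(a, b) \<in> S i. weight_of st (nxt i) b = Light \<and> g (nxt i, q, b) = c}) \<le> T) \<and>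
     (\<forall>i<k. \<forall>h\<in>{1..n}. weight_of st (nxt i) h = Heavy \<longrightarrow> (\<forall>c<fan st i h.
        real (card {a. (a, h) \<in> S i \<and> g (i, fan st i h, a) = c}) \<le> T)) \<and>
     (\<forall>i<k. \<forall>c<side. \<forall>c'<side.
        real (card {(a, b) \<in> S i. weight_of st i a \<noteq> Heavy \<and> weight_of st (nxt i) b \<noteq> Heavy \<and>
           g (i, side, a) = c \<and> g (nxt i, side, b) = c'}) \<le> T)"

lemma spread_left:
  assumes "spread T g" "i < k" "q \<in> {p, side\<^sup>2}" "c < q"
  shows "real (card {(a, b) \<in> S i. weight_of st i a = Light \<and> g (i, q, a) = c}) \<le> T"
  using assms unfolding spread_def by blast

lemma spread_right:
  assumes "spread T g" "i < k" "q \<in> {p, side\<^sup>2}" "c < q"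
  shows "real (card {(a, b) \<in> S i. weight_of st (nxt i) b = Light \<and> g (nxt i, q, b) = c}) \<le> T"
  using assms unfolding spread_def by blast

lemma spread_fan:
  assumes "spread T g" "i < k" "h \<in> {1..n}" "weight_of st (nxt i) h = Heavy" "c < fan st i h"
  shows "real (card {a. (a, h) \<in> S i \<and> g (i, fan st i h, a) = c}) \<le> T"
  using assms unfolding spread_def by blast

lemma spread_grid:
  assumes "spread T g" "i < k" "c < side" "c' < side"
  shows "real (card {(a, b) \<in> S i. weight_of st i a \<noteq> Heavy \<and> weight_of st (nxt i) b \<noteq> Heavy \<and>
           g (i, side, a) = c \<and> g (nxt i, side, b) = c'}) \<le> T"
  using assms unfolding spread_def by blast

lemma card_subset_le:
  fixes T :: real
  assumes "real (card B) \<le> T" "A \<subseteq> B" "finite B"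
  shows "real (card A) \<le> T"
  using card_mono[OF assms(3,2)] assms(1) by linarith

lemma finite_rel: "i < k \<Longrightarrow> finite {(a, b) \<in> S i. P a b}"
  by (rule finite_subset[OF _ finite_S[of i]]) auto

lemma finite_column: "i < k \<Longrightarrow> finite {a. (a, h) \<in> S i \<and> P a}"
  by (rule finite_subset[OF _ finite_imageI[OF finite_S[of i], of fst]]) force+

lemma coords_of_cell: "(\<tau>, y) \<in> cells st \<Longrightarrow> j < k \<Longrightarrow> y j \<in> coords st \<tau> j"
  by (auto simp: cells_def dest: PiE_mem)

section \<open>Facts that are sent to a single cell\<close>

definition fitting :: "hash \<Rightarrow> cell \<Rightarrow> nat \<Rightarrow> (nat \<times> nat) set" where
  "fitting g c i = {(a, b) \<in> S i. fits st g c i a \<and> fits st g c (nxt i) b}"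

lemma finite_fitting: "i < k \<Longrightarrow> finite (fitting g c i)"
  unfolding fitting_def by (rule finite_rel)

text \<open>If the two variables form a pair, the hash of a light one splits the relation into
  \<open>side\<^sup>2\<close> buckets. Otherwise neither belongs to a pair, each is hashed into
  \<open>side\<close> buckets, and the grid clause of \<open>spread\<close> applies.\<close>

lemma card_fitting_le:
  fixes T :: real
  assumes spread: "spread T g" and c: "(\<tau>, y) \<in> cells st" and i: "i < k"
    and nh: "\<tau> i \<noteq> Heavy" "\<tau> (nxt i) \<noteq> Heavy" and li: "\<tau> i = Light \<or> \<tau> (nxt i) = Light"
  shows "real (card (fitting g (\<tau>, y) i)) \<le> T"
proof -
  have ni: "\<not> isolated \<tau> i" "\<not> isolated \<tau> (nxt i)" "\<not> paired \<tau> (nxt i)"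
    using nh i by (auto simp: isolated_def paired_def)
  have bucket: "fst (y j) < side" if "j < k" "\<tau> j \<noteq> Heavy" for j
    using coords_of_cell[OF c that(1)] that(2) side_pos by (auto simp: coords_def split: if_splits)
  show ?thesis
  proof (cases "paired \<tau> i")
    case True
    let ?v = "fst (y i) + side * fst (y (nxt i))"
    have "?v < side + side * (side - 1)"
      using bucket[of i] bucket[of "nxt i"] nh i
      by (intro add_less_le_mono mult_le_mono2) auto
    also have "\<dots> = side\<^sup>2"
      using side_pos by (simp add: power2_eq_square algebra_simps)
    finally have v: "?v < side\<^sup>2" .
    show ?thesis
    proof (cases "\<tau> (nxt i) = Light")
      case l: True
      have "fitting g (\<tau>, y) i
          \<subseteq> {(a, b) \<in> S i. weight_of st (nxt i) b = Light \<and> g (nxt i, side\<^sup>2, b) = ?v}"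
        using True l ni nh i by (auto simp: fitting_def fits_def)
      then show ?thesis
        by (intro card_subset_le[OF spread_right[OF spread i _ v]] finite_rel[OF i]) simp_all
    next
      case False
      then have "fitting g (\<tau>, y) i
          \<subseteq> {(a, b) \<in> S i. weight_of st i a = Light \<and> g (i, side\<^sup>2, a) = ?v}"
        using True li ni nh i by (auto simp: fitting_def fits_def)
      then show ?thesis
        by (intro card_subset_le[OF spread_left[OF spread i _ v]] finite_rel[OF i]) simp_all
    qed
  next
    case False
    then have "\<not> paired \<tau> (prv i)"
      using nh i by (auto simp: paired_def)
    then have "fitting g (\<tau>, y) i \<subseteq> {(a, b) \<in> S i. weight_of st i a \<noteq> Heavy \<and>
        weight_of st (nxt i) b \<noteq> Heavy \<and> g (i, side, a) = fst (y i) \<and> g (nxt i, side, b) = fst (y (nxt i))}"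
      using False ni nh i by (auto simp: fitting_def fits_def)
    then show ?thesis
      by (rule card_subset_le[OF spread_grid[OF spread i bucket[OF i nh(1)] bucket[OF nxt_less nh(2)]]])
        (rule finite_rel[OF i])
  qed
qed

lemma card_isolated_le:
  fixes T :: real
  assumes spread: "spread T g" and c: "(\<tau>, y) \<in> cells st" and i: "i < k"
    and iso: "isolated \<tau> i"
  shows "real (card {a. (a, fst (y (nxt i))) \<in> S i \<and> fits st g (\<tau>, y) i a}) \<le> T"
proof -
  let ?h = "fst (y (nxt i))"
  have \<tau>: "\<tau> (nxt i) = Heavy" "\<tau> i \<noteq> Heavy" using iso by (auto simp: isolated_def)
  obtain h z where hz: "y (nxt i) = (h, z)" by fastforce
  then have "?h \<in> {1..n} \<and> weight_of st (nxt i) ?h = Heavy \<and> snd (y (nxt i)) < fan st i ?h"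
    using coords_of_cell[OF c nxt_less[of i]] \<tau> iso prv_nxt[OF i] by (simp add: coords_def)
  then have h: "?h \<in> {1..n}" "weight_of st (nxt i) ?h = Heavy" "snd (y (nxt i)) < fan st i ?h"
    by blast+
  have "{a. (a, ?h) \<in> S i \<and> fits st g (\<tau>, y) i a}
      \<subseteq> {a. (a, ?h) \<in> S i \<and> g (i, fan st i ?h, a) = snd (y (nxt i))}"
    using iso \<tau> by (auto simp: fits_def)
  then show ?thesis
    by (rule card_subset_le[OF spread_fan[OF spread i h] _ finite_column[OF i]])
qed

text \<open>Bounds what the servers of light left values forward to the cell, all senders taken
  together; the partner is sought in the whole input.\<close>

definition from_left :: "hash \<Rightarrow> cell \<Rightarrow> nat \<Rightarrow> (nat \<times> nat) set" where
  "from_left g c i = {(a, b) \<in> fitting g c i. weight_of st i a = Light \<and>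
     (\<exists>a'. (a', a) \<in> S (prv i) \<and> fits st g c (prv i) a')}"

definition from_right :: "hash \<Rightarrow> cell \<Rightarrow> nat \<Rightarrow> (nat \<times> nat) set" where
  "from_right g c i = {(a, b) \<in> fitting g c i. weight_of st (nxt i) b = Light \<and>
     (\<exists>b'. (b, b') \<in> S (nxt i) \<and> fits st g c (nxt (nxt i)) b')}"

lemma finite_from: "i < k \<Longrightarrow> finite (from_left g c i)" "i < k \<Longrightarrow> finite (from_right g c i)"
  by (auto simp: from_left_def from_right_def intro: finite_subset[OF _ finite_fitting])

text \<open>If the right variable is heavy, the cell fixes its value and only the left values are
  counted. They are bounded by the fan if the left variable is isolated; otherwise each of them, not
  being dangling, occurs in a fitting fact of the preceding relation.\<close>

lemma card_from_left_le:
  fixes T :: real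
  assumes spread: "spread T g" and T: "T \<ge> 0" and c: "(\<tau>, y) \<in> cells st" and i: "i < k"
  shows "real (card (from_left g (\<tau>, y) i)) \<le> T"
proof (cases "\<tau> i = Light")
  case False
  then have "from_left g (\<tau>, y) i = {}" by (auto simp: from_left_def fitting_def fits_def)
  then show ?thesis using T by simp
next
  case li: True
  show ?thesis
  proof (cases "\<tau> (nxt i) = Heavy")
    case False
    show ?thesis
      by (rule card_subset_le[OF card_fitting_le[OF spread c i] _ finite_fitting[OF i]])
        (use False li in \<open>auto simp: from_left_def\<close>)
  next
    case heavy: True
    have b: "(a, b) \<in> S i \<and> fits st g (\<tau>, y) i a \<and> b = fst (y (nxt i))"
      if "(a, b) \<in> from_left g (\<tau>, y) i" for a b
      using that heavy by (auto simp: from_left_def fitting_def fits_def)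
    have inj: "inj_on fst (from_left g (\<tau>, y) i)"
      using b by (auto simp: inj_on_def)
    show ?thesis
    proof (cases "\<tau> (prv i) = Heavy")
      case True
      then have "isolated \<tau> i" using heavy li by (simp add: isolated_def)
      then have "real (card {a. (a, fst (y (nxt i))) \<in> S i \<and> fits st g (\<tau>, y) i a}) \<le> T"
        by (rule card_isolated_le[OF spread c i])
      moreover have "fst ` from_left g (\<tau>, y) i \<subseteq> {a. (a, fst (y (nxt i))) \<in> S i \<and> fits st g (\<tau>, y) i a}"
        using b by fastforce
      ultimately have "real (card (fst ` from_left g (\<tau>, y) i)) \<le> T"
        using finite_column[OF i] by (rule card_subset_le)
      then show ?thesis by (simp add: card_image[OF inj])
    next
      case False
      have "fst ` from_left g (\<tau>, y) i \<subseteq> snd ` fitting g (\<tau>, y) (prv i)"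
        using i by (force simp: from_left_def fitting_def)
      then have "card (fst ` from_left g (\<tau>, y) i) \<le> card (fitting g (\<tau>, y) (prv i))"
        by (rule surj_card_le[OF finite_fitting[OF prv_less]])
      moreover have "real (card (fitting g (\<tau>, y) (prv i))) \<le> T"
        using False li i by (intro card_fitting_le[OF spread c]) auto
      ultimately show ?thesis by (simp add: card_image[OF inj])
    qed
  qed
qed

text \<open>Mirrors \<open>card_from_left_le\<close> except for an isolated variable: its buckets
  are sized by the degree of its heavy successor, not its predecessor. The required partner forces
  an edge to that successor value, so the fan bound still applies.\<close>

lemma card_from_right_le:
  fixes T :: real
  assumes spread: "spread T g" and T: "T \<ge> 0" and c: "(\<tau>, y) \<in> cells st" and i: "i < k"
  shows "real (card (from_right g (\<tau>, y) i)) \<le> T"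
proof (cases "\<tau> (nxt i) = Light")
  case False
  then have "from_right g (\<tau>, y) i = {}" by (auto simp: from_right_def fitting_def fits_def)
  then show ?thesis using T by simp
next
  case li: True
  show ?thesis
  proof (cases "\<tau> i = Heavy")
    case False
    show ?thesis
      by (rule card_subset_le[OF card_fitting_le[OF spread c i] _ finite_fitting[OF i]])
        (use False li in \<open>auto simp: from_right_def\<close>)
  next
    case heavy: True
    have inj: "inj_on snd (from_right g (\<tau>, y) i)"
      using heavy by (auto simp: inj_on_def from_right_def fitting_def fits_def)
    show ?thesis
    proof (cases "\<tau> (nxt (nxt i)) = Heavy")
      case True
      then have "isolated \<tau> (nxt i)" using heavy li i by (simp add: isolated_def)
      then have "real (card {b. (b, fst (y (nxt (nxt i)))) \<in> S (nxt i) \<and> fits st g (\<tau>, y) (nxt i) b}) \<le> T"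
        by (rule card_isolated_le[OF spread c nxt_less])
      moreover have "snd ` from_right g (\<tau>, y) i
          \<subseteq> {b. (b, fst (y (nxt (nxt i)))) \<in> S (nxt i) \<and> fits st g (\<tau>, y) (nxt i) b}"
        using True by (auto simp: from_right_def fitting_def) (auto simp: fits_def)
      ultimately have "real (card (snd ` from_right g (\<tau>, y) i)) \<le> T"
        using finite_column[OF nxt_less] by (rule card_subset_le)
      then show ?thesis by (simp add: card_image[OF inj])
    next
      case False
      have "snd ` from_right g (\<tau>, y) i \<subseteq> fst ` fitting g (\<tau>, y) (nxt i)"
        by (force simp: from_right_def fitting_def)
      then have "card (snd ` from_right g (\<tau>, y) i) \<le> card (fitting g (\<tau>, y) (nxt i))"
        by (rule surj_card_le[OF finite_fitting[OF nxt_less]])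
      moreover have "real (card (fitting g (\<tau>, y) (nxt i))) \<le> T"
        using False li i by (intro card_fitting_le[OF spread c]) auto
      ultimately show ?thesis by (simp add: card_image[OF inj])
    qed
  qed
qed

text \<open>A fact is forwarded only by the server to which one of its light values is hashed, so
  the senders split \<open>from_left\<close> and \<open>from_right\<close> into disjoint
  fibers.\<close>

lemma round2_cell_le:
  fixes T :: real
  assumes spread: "spread T g" and T: "T \<ge> 0" and c: "c \<in> cells st"
  shows "real (\<Sum>t<p. card (forward st g (known1 g t) t c)) \<le> 2 * k * T"
proof -
  let ?L = "\<lambda>t i. {x \<in> from_left g c i. g (i, p, fst x) = t}"
  let ?R = "\<lambda>t i. {x \<in> from_right g c i. g (nxt i, p, snd x) = t}"
  have fin: "finite (?L t i)" "finite (?R t i)" if "i < k" for t i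
    using finite_from[OF that] by auto
  have "card (forward st g (known1 g t) t c) \<le> (\<Sum>i<k. card (?L t i) + card (?R t i))" for t
  proof -
    have "forward st g (known1 g t) t c \<subseteq> (\<Union>i<k. Pair i ` (?L t i \<union> ?R t i))"
    proof
      fix f assume "f \<in> forward st g (known1 g t) t c"
      then obtain i a b where f: "f = (i, a, b)" "(i, a, b) \<in> F" "fits st g c i a" "fits st g c (nxt i) b"
        and d: "weight_of st i a = Light \<and> g (i, p, a) = t \<and>
            (\<exists>a'. (prv i, a', a) \<in> F \<and> fits st g c (prv i) a') \<or>
          weight_of st (nxt i) b = Light \<and> g (nxt i, p, b) = t \<and>
            (\<exists>b'. (nxt i, b, b') \<in> F \<and> fits st g c (nxt (nxt i)) b')"
        unfolding forward_def known1_def by blast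
      have "i < k" "(a, b) \<in> ?L t i \<union> ?R t i"
        using f(2-4) d by (auto simp: mem_facts from_left_def from_right_def fitting_def)
      then show "f \<in> (\<Union>i<k. Pair i ` (?L t i \<union> ?R t i))" using f(1) by blast
    qed
    then have "card (forward st g (known1 g t) t c) \<le> card (\<Union>i<k. Pair i ` (?L t i \<union> ?R t i))"
      using fin by (intro card_mono finite_UN_I finite_imageI finite_UnI) auto
    also have "\<dots> \<le> (\<Sum>i<k. card (Pair i ` (?L t i \<union> ?R t i)))" by (rule card_UN_le) simp
    also have "\<dots> \<le> (\<Sum>i<k. card (?L t i) + card (?R t i))"
      by (intro sum_mono order_trans[OF card_image_le card_Un_le]) (use fin in auto)
    finally show ?thesis .
  qed
  then have "(\<Sum>t<p. card (forward st g (known1 g t) t c))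
      \<le> (\<Sum>t<p. \<Sum>i<k. card (?L t i) + card (?R t i))" by (rule sum_mono)
  also have "\<dots> = (\<Sum>i<k. (\<Sum>t<p. card (?L t i)) + (\<Sum>t<p. card (?R t i)))"
    by (subst sum.swap) (simp add: sum.distrib)
  also have "\<dots> \<le> (\<Sum>i<k. card (from_left g c i) + card (from_right g c i))"
    by (intro sum_mono add_mono sum_card_fibers_le finite_from) auto
  finally have "real (\<Sum>t<p. card (forward st g (known1 g t) t c))
      \<le> real (\<Sum>i<k. card (from_left g c i) + card (from_right g c i))"
    by (simp only: of_nat_le_iff)
  also have "\<dots> \<le> (\<Sum>i<k. T + T)"
    unfolding of_nat_sum of_nat_add
    using card_from_left_le[OF spread T] card_from_right_le[OF spread T] c
    by (cases c) (intro sum_mono add_mono, auto)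
  finally show ?thesis by simp
qed

section \<open>Facts received by a server in each round\<close>

lemma round2_le:
  fixes T :: real
  assumes spread: "spread T g" and T: "T \<ge> 0"
  shows "real (\<Sum>t<p. card (round2 st g (known1 g t) t s)) \<le> (18 ^ k + 1) * (2 * k * T)"
proof -
  let ?C = "{c \<in> cells st. server_of st c = s}"
  have fin: "finite ?C" using finite_cells by simp
  have "(\<Sum>t<p. card (round2 st g (known1 g t) t s)) \<le> (\<Sum>t<p. \<Sum>c\<in>?C. card (forward st g (known1 g t) t c))"
    unfolding round2_def using fin by (intro sum_mono card_UN_le)
  also have "\<dots> = (\<Sum>c\<in>?C. \<Sum>t<p. card (forward st g (known1 g t) t c))" by (rule sum.swap)
  finally have "real (\<Sum>t<p. card (round2 st g (known1 g t) t s))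
      \<le> real (\<Sum>c\<in>?C. \<Sum>t<p. card (forward st g (known1 g t) t c))" by (simp only: of_nat_le_iff)
  also have "\<dots> = (\<Sum>c\<in>?C. real (\<Sum>t<p. card (forward st g (known1 g t) t c)))" by (rule of_nat_sum)
  also have "\<dots> \<le> (\<Sum>c\<in>?C. 2 * k * T)"
    using round2_cell_le[OF spread T] by (intro sum_mono) blast
  also have "\<dots> = real (card ?C) * (2 * k * T)" by simp
  also have "\<dots> \<le> real (18 ^ k + 1) * (2 * k * T)"
    using card_cells_of_server[of s] T by (intro mult_right_mono) (auto simp only: of_nat_le_iff, simp)
  finally show ?thesis by (simp add: add.commute)
qed

lemma round1_le:
  fixes T :: real
  assumes spread: "spread T g" and s: "s < p"
  shows "real (\<Sum>t<p. card (D t \<inter> round1 st g s)) \<le> k * (4 * real p ^ 2 + 2 * T)"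
proof -
  let ?N = "\<lambda>i. {a \<in> {1..n}. weight_of st i a \<noteq> Light}"
  let ?L = "\<lambda>i. {(a, b) \<in> S i. weight_of st i a = Light \<and> g (i, p, a) = s}"
  let ?R = "\<lambda>i. {(a, b) \<in> S i. weight_of st (nxt i) b = Light \<and> g (nxt i, p, b) = s}"
  have finD: "finite (D t)" if "t < p" for t
  proof (rule finite_subset[OF _ finite_universe])
    show "D t \<subseteq> universe k n" using Union_D facts_universe that by blast
  qed
  have fin: "finite (?N i \<times> ?N (nxt i) \<union> (?L i \<union> ?R i))" if "i < k" for i
    by (intro finite_UnI finite_rel finite_cartesian_product that) auto
  \<comment> \<open>The initial parts are disjoint, so no fact arrives twice in round one.\<close>
  have "(\<Sum>t<p. card (D t \<inter> round1 st g s)) = card (\<Union>t<p. D t \<inter> round1 st g s)"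
    using disjoint_D finD by (intro card_UN_disjoint[symmetric]) (auto simp: disjoint_family_on_def)
  also have "(\<Union>t<p. D t \<inter> round1 st g s) = F \<inter> round1 st g s"
    using Union_D by auto
  also have "F \<inter> round1 st g s \<subseteq> (\<Union>i<k. Pair i ` (?N i \<times> ?N (nxt i) \<union> (?L i \<union> ?R i)))"
  proof
    fix f assume "f \<in> F \<inter> round1 st g s"
    then obtain i a b where f: "f = (i, a, b)" "i < k" "(a, b) \<in> S i" "(i, a, b) \<in> round1 st g s"
      by (auto simp: facts_def)
    then have "(a, b) \<in> ?N i \<times> ?N (nxt i) \<union> (?L i \<union> ?R i)"
      using S_subset[OF f(2)] by (auto simp: round1_def)
    then show "f \<in> (\<Union>i<k. Pair i ` (?N i \<times> ?N (nxt i) \<union> (?L i \<union> ?R i)))"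
      using f by blast
  qed
  then have "card (F \<inter> round1 st g s) \<le> card (\<Union>i<k. Pair i ` (?N i \<times> ?N (nxt i) \<union> (?L i \<union> ?R i)))"
    using fin by (intro card_mono finite_UN_I finite_imageI) auto
  also have "\<dots> \<le> (\<Sum>i<k. card (Pair i ` (?N i \<times> ?N (nxt i) \<union> (?L i \<union> ?R i))))"
    by (rule card_UN_le) simp
  also have "\<dots> \<le> (\<Sum>i<k. card (?N i) * card (?N (nxt i)) + (card (?L i) + card (?R i)))"
  proof (rule sum_mono)
    fix i assume "i \<in> {..<k}"
    then have "card (Pair i ` (?N i \<times> ?N (nxt i) \<union> (?L i \<union> ?R i))) \<le> card (?N i \<times> ?N (nxt i) \<union> (?L i \<union> ?R i))"
      using fin by (intro card_image_le) auto
    also have "\<dots> \<le> card (?N i \<times> ?N (nxt i)) + (card (?L i) + card (?R i))"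
      by (rule order_trans[OF card_Un_le add_left_mono[OF card_Un_le]])
    finally show "card (Pair i ` (?N i \<times> ?N (nxt i) \<union> (?L i \<union> ?R i)))
        \<le> card (?N i) * card (?N (nxt i)) + (card (?L i) + card (?R i))"
      by (simp add: card_cartesian_product)
  qed
  finally have "real (\<Sum>t<p. card (D t \<inter> round1 st g s))
      \<le> real (\<Sum>i<k. card (?N i) * card (?N (nxt i)) + (card (?L i) + card (?R i)))"
    by (simp only: of_nat_le_iff)
  also have "\<dots> \<le> (\<Sum>i<k. real (2 * p) * real (2 * p) + (T + T))"
    unfolding of_nat_sum of_nat_add of_nat_mult
  proof (intro sum_mono add_mono)
    fix i assume "i \<in> {..<k}"
    then have i: "i < k" by simp
    show "real (card (?N i)) * real (card (?N (nxt i))) \<le> real 2 * real p * (real 2 * real p)"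
      using card_not_light[OF i] card_not_light[OF nxt_less[of i]]
      by (intro mult_mono) (auto simp only: of_nat_mult[symmetric] of_nat_le_iff of_nat_0_le_iff)
    show "real (card (?L i)) \<le> T" "real (card (?R i)) \<le> T"
      using spread_left[OF spread i _ s] spread_right[OF spread i _ s] by simp_all
  qed
  finally show ?thesis by (simp add: power2_eq_square algebra_simps)
qed

subsection \<open>Hash values are well spread with high probability\<close>

definition quota :: real where "quota = real m / real side ^ 2"

text \<open>Read as \<open>5 * quota * (2 + 4 * ln p)\<close>: 5 absorbs the constants in the bucket
  averages, and \<open>4 * ln p\<close> yields failure probability \<open>1 / p ^ 4\<close>.\<close>

definition threshold :: real where "threshold = quota * (10 + 20 * ln (real p))"

lemma quota_pos: "quota > 0"
  using m_pos side_pos by (simp add: quota_def)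

lemma ln_p: "ln (real p) \<ge> 0"
  using p by simp

lemma exp_ln_p: "exp (- 4 * ln (real p)) = 1 / real p ^ 4"
proof -
  have "exp (4 * ln (real p)) = real p ^ 4"
    using p exp_of_nat_mult[of 4 "ln (real p)"] by simp
  then show ?thesis by (simp add: exp_minus inverse_eq_divide)
qed

lemma quota_ge: "quota \<ge> real p ^ 3"
proof -
  have "real p ^ 3 * real side ^ 2 \<le> real p ^ 3 * real p ^ 2"
    using side_le_p by (intro mult_left_mono power_mono) auto
  also have "\<dots> = real p ^ 5" by (simp flip: power_add)
  also have "\<dots> \<le> m" by (rule m)
  finally show ?thesis using side_pos by (simp add: quota_def pos_le_divide_eq)
qed

lemma m_le_quota: "real m \<le> 4 * quota * p"
proof -
  have "real m * real side ^ 2 \<le> real m * (4 * p)"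
    using side_square_le_p by (intro mult_left_mono) (simp_all flip: of_nat_power)
  then show ?thesis using side_pos by (simp add: quota_def field_simps)
qed

text \<open>The second component has an arbitrary type, so that converse relations and, with
  \<open>unit\<close>, plain sets of values are instances.\<close>

lemma hash_tail:
  fixes R :: "(nat \<times> 'b) set" and b t :: real
  assumes i: "i < k" and q: "q \<ge> 1" "q \<le> p + side\<^sup>2 + 1" and c: "c < q"
    and R: "finite R" "fst ` R \<subseteq> {1..n}" and rows: "\<And>a. real (card {x. (a, x) \<in> R}) \<le> b" and b: "b > 0"
  shows "measure_pmf.prob hash_pmf {g. t < real (card {(a, x) \<in> R. g (i, q, a) = c})}
     \<le> exp ((2 * real (card R) / q - t) / b)"
proof -
  have inj: "inj_on (\<lambda>a. (i, q, a)) {1..n}" by (simp add: inj_on_def)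
  let ?w = "\<lambda>a. real (card {x. (a, x) \<in> R})"
  have "measure_pmf.prob hash_pmf
       {g. t \<le> (\<Sum>x\<in>(\<lambda>a. (i, q, a)) ` {1..n}. (?w \<circ> snd \<circ> snd) x * of_bool (g x = c))}
     \<le> exp ((2 * (\<Sum>x\<in>(\<lambda>a. (i, q, a)) ` {1..n}. (?w \<circ> snd \<circ> snd) x) / q - t) / b)"
    unfolding hash_pmf_def
    by (rule bucket_tail) (use i q c rows b in \<open>auto simp: hash_index_def\<close>)
  then have tail: "measure_pmf.prob hash_pmf {g. t \<le> (\<Sum>a\<in>{1..n}. ?w a * of_bool (g (i, q, a) = c))}
     \<le> exp ((2 * (\<Sum>a\<in>{1..n}. ?w a) / q - t) / b)"
    unfolding sum.reindex[OF inj] by (simp add: o_def)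
  have card: "(\<Sum>a\<in>{1..n}. ?w a) = real (card R)"
    using real_card_rows[OF R(1) _ R(2), of "\<lambda>_. True"] by simp
  have "{g. t < real (card {(a, x) \<in> R. g (i, q, a) = c})}
      \<subseteq> {g. t \<le> (\<Sum>a\<in>{1..n}. ?w a * of_bool (g (i, q, a) = c))}"
    using real_card_rows[OF R(1) _ R(2)] by auto
  then have "measure_pmf.prob hash_pmf {g. t < real (card {(a, x) \<in> R. g (i, q, a) = c})}
      \<le> measure_pmf.prob hash_pmf {g. t \<le> (\<Sum>a\<in>{1..n}. ?w a * of_bool (g (i, q, a) = c))}"
    by (rule measure_pmf.finite_measure_mono) simp
  then show ?thesis using tail unfolding card by (rule order_trans)
qed

text \<open>The average bucket holds at most \<open>b\<close>, so twice the average uses up the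
  summand 2 and the exponent is at most \<open>- 4 * ln p\<close>.\<close>

lemma hash_overflow:
  fixes R :: "(nat \<times> 'b) set" and b T :: real
  assumes i: "i < k" and q: "q \<ge> 1" "q \<le> p + side\<^sup>2 + 1" and c: "c < q"
    and R: "finite R" "fst ` R \<subseteq> {1..n}" and rows: "\<And>a. real (card {x. (a, x) \<in> R}) \<le> b" and b: "b > 0"
    and card: "real (card R) \<le> b * q" and T: "b * (2 + 4 * ln p) = T"
  shows "measure_pmf.prob hash_pmf {g. T < real (card {(a, x) \<in> R. g (i, q, a) = c})} \<le> 1 / real p ^ 4"
proof -
  have "measure_pmf.prob hash_pmf {g. T < real (card {(a, x) \<in> R. g (i, q, a) = c})}
      \<le> exp ((2 * real (card R) / q - T) / b)"
    using i q c R rows b by (rule hash_tail)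
  also have "(2 * real (card R) / q - T) / b \<le> - 4 * ln p"
  proof -
    have "2 * real (card R) / q \<le> 2 * b"
      using card q by (simp add: divide_le_eq)
    then have "2 * real (card R) / q - T \<le> - 4 * ln p * b"
      unfolding T[symmetric] by (simp add: algebra_simps)
    then show ?thesis using b by (simp add: pos_divide_le_eq)
  qed
  finally show ?thesis unfolding exp_ln_p[symmetric] by simp
qed

lemma threshold_eq: "5 * quota * (2 + 4 * ln p) = threshold"
  by (simp add: threshold_def algebra_simps)

lemma m_le_bucket:
  assumes "q \<in> {p, side\<^sup>2}"
  shows "real m \<le> 5 * quota * q"
proof -
  have "quota * p \<ge> 0" using quota_pos by simp
  moreover have "real m = quota * side\<^sup>2" using side_pos by (simp add: quota_def)
  ultimately show ?thesis using assms m_le_quota m_pos by auto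
qed

lemma light_degree:
  assumes "p * d \<le> m"
  shows "real d \<le> 5 * quota"
proof -
  have "real p * real d \<le> real m" using assms by (metis of_nat_le_iff of_nat_mult)
  also have "\<dots> \<le> real p * (5 * quota)" using m_le_bucket[of p] by (simp add: mult.commute)
  finally show ?thesis using p by simp
qed

lemma overflow_left:
  assumes i: "i < k" and q: "q \<in> {p, side\<^sup>2}" and c: "c < q"
  shows "measure_pmf.prob hash_pmf
    {g. threshold < real (card {(a, b) \<in> S i. weight_of st i a = Light \<and> g (i, q, a) = c})} \<le> 1 / real p ^ 4"
proof -
  let ?R = "{(a, b) \<in> S i. weight_of st i a = Light}"
  have fin: "finite ?R" by (rule finite_rel[OF i])
  have "measure_pmf.prob hash_pmf {g. threshold < real (card {(a, b) \<in> ?R. g (i, q, a) = c})} \<le> 1 / real p ^ 4"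
  proof (rule hash_overflow[OF i _ _ c fin _ _ _ _ threshold_eq])
    show "1 \<le> q" using c by simp
    show "q \<le> p + side\<^sup>2 + 1" using q by auto
    show "fst ` ?R \<subseteq> {1..n}" using S_subset[OF i] by auto
    show "real (card {b. (a, b) \<in> ?R}) \<le> 5 * quota" for a
    proof (cases "weight_of st i a = Light")
      case True
      then show ?thesis using light_degree[OF light(1)[OF i True]] by (simp add: outdeg_def)
    qed (use quota_pos in simp)
    have "card ?R \<le> m" using card_mono[OF finite_S[OF i], of ?R] card_S[OF i] by auto
    then show "real (card ?R) \<le> 5 * quota * q" using m_le_bucket[OF q] by linarith
  qed (use quota_pos in simp)
  then show ?thesis by (simp add: conj_assoc)
qed

lemma overflow_right:
  assumes i: "i < k" and q: "q \<in> {p, side\<^sup>2}" and c: "c < q"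
  shows "measure_pmf.prob hash_pmf
    {g. threshold < real (card {(a, b) \<in> S i. weight_of st (nxt i) b = Light \<and> g (nxt i, q, b) = c})} \<le> 1 / real p ^ 4"
proof -
  let ?R = "{(b, a). (a, b) \<in> S i \<and> weight_of st (nxt i) b = Light}"
  have sub: "?R \<subseteq> (S i)\<inverse>" by auto
  have fin: "finite ?R" using finite_subset[OF sub] finite_S[OF i] by simp
  have "measure_pmf.prob hash_pmf {g. threshold < real (card {(b, a) \<in> ?R. g (nxt i, q, b) = c})} \<le> 1 / real p ^ 4"
  proof (rule hash_overflow[OF nxt_less _ _ c fin _ _ _ _ threshold_eq])
    show "1 \<le> q" using c by simp
    show "q \<le> p + side\<^sup>2 + 1" using q by auto
    show "fst ` ?R \<subseteq> {1..n}" using S_subset[OF i] by auto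
    show "real (card {a. (b, a) \<in> ?R}) \<le> 5 * quota" for b
    proof (cases "weight_of st (nxt i) b = Light")
      case True
      then show ?thesis using light_degree[OF light(2)[OF nxt_less True]] i by (simp add: indeg_def)
    qed (use quota_pos in simp)
    have "card ?R \<le> m" using card_mono[OF _ sub] finite_S[OF i] card_S[OF i] by simp
    then show "real (card ?R) \<le> 5 * quota * q" using m_le_bucket[OF q] by linarith
  qed (use quota_pos in simp)
  moreover have "card {(b, a) \<in> ?R. g (nxt i, q, b) = c}
      = card {(a, b) \<in> S i. weight_of st (nxt i) b = Light \<and> g (nxt i, q, b) = c}" for g :: hash
    by (rule bij_betw_same_card[of prod.swap]) (auto simp: bij_betw_def inj_on_def image_iff)
  ultimately show ?thesis by simp
qed

text \<open>The 5 is 1 + 4: a recorded degree is at most \<open>quota * fan st i h\<close>, and an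
  unrecorded one is below \<open>m / p\<close>, hence at most \<open>4 * quota\<close>.\<close>

lemma fan_bounds:
  assumes i: "i < k"
  shows "real (indeg i h) \<le> 5 * quota * fan st i h" "fan st i h \<le> p + side\<^sup>2 + 1"
proof -
  let ?d = "st i (None, Some h)"
  have le: "?d \<le> indeg i h" using stat_in[OF i] by simp
  have "real (side\<^sup>2 * ?d) \<le> real (m * fan st i h)"
  proof -
    have "side\<^sup>2 * ?d = m * (side\<^sup>2 * ?d div m) + side\<^sup>2 * ?d mod m" by simp
    also have "\<dots> \<le> m * (side\<^sup>2 * ?d div m) + m"
      using m_pos by (intro add_left_mono less_imp_le mod_less_divisor)
    finally show ?thesis unfolding of_nat_le_iff by (simp add: fan_def stat_size)
  qed
  then have d: "real ?d \<le> quota * fan st i h"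
    using side_pos by (simp add: quota_def field_simps)
  have f1: "real (fan st i h) \<ge> 1" by (simp add: fan_def)
  have "real (indeg i h) \<le> real ?d + 4 * quota"
  proof (cases "m \<le> p * indeg i h")
    case True
    then show ?thesis using quota_pos stat_in[OF i] by simp
  next
    case False
    then have "real p * real (indeg i h) \<le> real m" by (metis linear of_nat_le_iff of_nat_mult)
    then have "real p * real (indeg i h) \<le> real p * (4 * quota)" using m_le_quota by (simp add: mult.commute)
    then show ?thesis using p by simp
  qed
  also have "\<dots> \<le> quota * fan st i h + 4 * quota * fan st i h"
    using d f1 quota_pos by (intro add_mono) auto
  finally show "real (indeg i h) \<le> 5 * quota * fan st i h" by (simp add: algebra_simps)
  have "indeg i h \<le> m"
    unfolding indeg_def card_S[OF i, symmetric]
    by (rule card_inj_on_le[of "\<lambda>a. (a, h)"]) (auto simp: inj_on_def finite_S[OF i])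
  then have "side\<^sup>2 * ?d div m \<le> side\<^sup>2 * m div m" using le by (intro div_le_mono mult_le_mono2) linarith
  then show "fan st i h \<le> p + side\<^sup>2 + 1" using m_pos by (simp add: fan_def stat_size)
qed

lemma overflow_fan:
  assumes i: "i < k" and c: "c < fan st i h"
  shows "measure_pmf.prob hash_pmf
    {g. threshold < real (card {a. (a, h) \<in> S i \<and> g (i, fan st i h, a) = c})} \<le> 1 / real p ^ 4"
proof -
  let ?R = "{a. (a, h) \<in> S i} \<times> {()}"
  have fin: "finite ?R" using finite_column[OF i, of h "\<lambda>_. True"] by simp
  have "measure_pmf.prob hash_pmf {g. threshold < real (card {(a, b) \<in> ?R. g (i, fan st i h, a) = c})} \<le> 1 / real p ^ 4"
  proof (rule hash_overflow[OF i _ _ c fin _ _ _ _ threshold_eq])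
    show "1 \<le> fan st i h" by (simp add: fan_def)
    show "fst ` ?R \<subseteq> {1..n}" using S_subset[OF i] by auto
    show "real (card {b. (a, b) \<in> ?R}) \<le> 5 * quota" for a
    proof -
      have "card {b. (a, b) \<in> ?R} \<le> card {()}" by (rule card_mono) auto
      moreover have "1 \<le> real p ^ 3" using p by simp
      ultimately show ?thesis using quota_ge by simp
    qed
    show "real (card ?R) \<le> 5 * quota * fan st i h"
      using fan_bounds(1)[OF i] by (simp add: indeg_def card_cartesian_product)
  qed (use quota_pos fan_bounds[OF i] in auto)
  moreover have "card {(a, b) \<in> ?R. g (i, fan st i h, a) = c} = card {a. (a, h) \<in> S i \<and> g (i, fan st i h, a) = c}" for g
    by (rule bij_betw_same_card[of fst]) (auto simp: bij_betw_def inj_on_def image_iff)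
  ultimately show ?thesis by simp
qed

text \<open>Hashing the left ends first, every right value should keep at most
  \<open>3 * quota\<close> edges in a bucket (else \<open>?A\<close>) and the bucket at most
  \<open>W\<close> edges in total (else \<open>?B\<close>). Given both, \<open>grid_tail\<close>
  treats the right ends (\<open>?C\<close>). There may be up to \<open>m\<close> right values, so
  \<open>?A\<close> needs a bound that is exponentially small in \<open>quota\<close>.\<close>

lemma overflow_grid:
  assumes i: "i < k"
  shows "measure_pmf.prob hash_pmf {g. \<exists>c<side. \<exists>c'<side.
      threshold < real (card {(a, b) \<in> S i. weight_of st i a \<noteq> Heavy \<and> weight_of st (nxt i) b \<noteq> Heavy \<and>
           g (i, side, a) = c \<and> g (nxt i, side, b) = c'})}
    \<le> real m * side * exp (- quota) + (side + side\<^sup>2) / real p ^ 4"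
proof -
  define E where "E = {(a, b) \<in> S i. weight_of st i a \<noteq> Heavy \<and> weight_of st (nxt i) b \<noteq> Heavy}"
  define W where "W = real m / side * (2 + 4 * ln p)"
  have sub: "E \<subseteq> S i" by (auto simp: E_def)
  have fin: "finite E" using sub finite_S[OF i] by (rule finite_subset)
  have card_E: "card E \<le> m" using card_mono[OF finite_S[OF i] sub] card_S[OF i] by simp
  have E_le: "a \<in> {1..n}" "b \<in> {1..n}" if "(a, b) \<in> E" for a b
    using that sub S_subset[OF i] by auto
  have side_q: "1 \<le> side" "side \<le> p + side\<^sup>2 + 1" using side_pos side_le_p by auto
  have quota_side: "real m / side = quota * side" "real m = quota * side * side"
    using side_pos by (simp_all add: quota_def power2_eq_square)
  have out: "real (card {b. (a, b) \<in> E}) \<le> real m / side" for a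
  proof (cases "weight_of st i a = Heavy")
    case False
    have "card {b. (a, b) \<in> E} \<le> outdeg i a"
      unfolding outdeg_def
      using sub finite_subset[of "{b. (a, b) \<in> S i}" "{1..n}"] S_subset[OF i] by (intro card_mono) auto
    then have "side * card {b. (a, b) \<in> E} \<le> m"
      using not_heavy(1)[OF i False] by (meson le_trans mult_le_mono2)
    then have "real side * real (card {b. (a, b) \<in> E}) \<le> real m" by (metis of_nat_le_iff of_nat_mult)
    then show ?thesis using side_pos by (simp add: pos_le_divide_eq mult.commute)
  qed (simp add: E_def)
  have inc: "real (card {a. (a, b) \<in> E}) \<le> real m / side" for b
  proof (cases "weight_of st (nxt i) b = Heavy")
    case False
    have "card {a. (a, b) \<in> E} \<le> indeg i b"
      unfolding indeg_def
      by (rule card_mono) (use sub finite_column[OF i, of b "\<lambda>_. True"] in auto)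
    then have "side * card {a. (a, b) \<in> E} \<le> m"
      using not_heavy(2)[OF nxt_less False] i by (simp) (meson le_trans mult_le_mono2)
    then have "real side * real (card {a. (a, b) \<in> E}) \<le> real m" by (metis of_nat_le_iff of_nat_mult)
    then show ?thesis using side_pos by (simp add: pos_le_divide_eq mult.commute)
  qed (simp add: E_def)
  let ?A = "\<lambda>(b, c). {g :: hash. 3 * quota < real (card {a. (a, b) \<in> E \<and> g (i, side, a) = c})}"
  let ?B = "\<lambda>c. {g :: hash. W < real (card {(a, b) \<in> E. g (i, side, a) = c})}"
  let ?C = "\<lambda>(c, c'). {g :: hash. (\<forall>b\<in>snd ` E. real (card {a. (a, b) \<in> E \<and> g (i, side, a) = c}) \<le> 3 * quota) \<and>
      real (card {(a, b) \<in> E. g (i, side, a) = c}) \<le> W \<and>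
      threshold \<le> real (card {(a, b) \<in> E. g (i, side, a) = c \<and> g (nxt i, side, b) = c'})}"
  have A: "measure_pmf.prob hash_pmf (?A x) \<le> exp (- quota)" if x: "x \<in> snd ` E \<times> {..<side}" for x
  proof -
    obtain b c where bc: "x = (b, c)" "c < side" using x by auto
    let ?R = "{a. (a, b) \<in> E} \<times> {()}"
    have "finite {a. (a, b) \<in> E}"
      by (rule finite_subset[OF _ finite_column[OF i, of b "\<lambda>_. True"]]) (use sub in auto)
    then have finR: "finite ?R" by simp
    have "measure_pmf.prob hash_pmf {g. 3 * quota < real (card {(a, x) \<in> ?R. g (i, side, a) = c})}
      \<le> exp ((2 * real (card ?R) / side - 3 * quota) / 1)"
    proof (rule hash_tail[OF i side_q bc(2) finR])
      show "fst ` ?R \<subseteq> {1..n}" using E_le by auto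
      show "real (card {x. (a, x) \<in> ?R}) \<le> 1" for a
        using card_mono[of "{()}" "{x. (a, x) \<in> ?R}"] by auto
    qed simp
    also have "\<dots> \<le> exp (- quota)"
    proof -
      have "real (card ?R) \<le> quota * side" using inc[of b] quota_side(1) by (simp add: card_cartesian_product)
      then show ?thesis using side_pos by (simp add: field_simps)
    qed
    finally have "measure_pmf.prob hash_pmf {g. 3 * quota < real (card {(a, x) \<in> ?R. g (i, side, a) = c})}
      \<le> exp (- quota)" .
    moreover have "{(a, x) \<in> ?R. g (i, side, a) = c} = {a. (a, b) \<in> E \<and> g (i, side, a) = c} \<times> {()}" for g :: hash
      by auto
    ultimately show ?thesis by (simp add: bc card_cartesian_product)
  qed
  have B: "measure_pmf.prob hash_pmf (?B c) \<le> 1 / real p ^ 4" if "c \<in> {..<side}" for c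
  proof (rule hash_overflow[OF i side_q _ fin _ out])
    show "real (card E) \<le> real m / side * side" using card_E side_pos by simp
  qed (use that E_le m_pos side_pos in \<open>auto simp: W_def\<close>)
  have C: "measure_pmf.prob hash_pmf (?C x) \<le> 1 / real p ^ 4" if xs: "x \<in> {..<side} \<times> {..<side}" for x
  proof -
    obtain c c' where x: "x = (c, c')" "c' < side" using xs by auto
    have "measure_pmf.prob hash_pmf (?C (c, c')) \<le> exp ((2 * W / side - threshold) / (3 * quota))"
      unfolding hash_pmf_def prod.case
    proof (rule grid_tail[where u = "\<lambda>a. (i, side, a)" and v = "\<lambda>b. (nxt i, side, b)"])
      show "inj_on (\<lambda>b. (nxt i, side, b)) (snd ` E)" by (simp add: inj_on_def)
      show "(\<lambda>a. (i, side, a)) ` fst ` E \<inter> (\<lambda>b. (nxt i, side, b)) ` snd ` E = {}"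
        using nxt_neq[OF i] by auto
      show "(\<lambda>a. (i, side, a)) ` fst ` E \<subseteq> hash_index" "(\<lambda>b. (nxt i, side, b)) ` snd ` E \<subseteq> hash_index"
        using i side_q E_le by (auto simp: hash_index_def)
    qed (use fin x quota_pos in auto)
    \<comment> \<open>Here \<open>2 * W / side\<close> is \<open>quota * (4 + 8 * ln p)\<close>,
      leaving \<open>- quota * (6 + 12 * ln p)\<close> in the numerator.\<close>
    also have "(2 * W / side - threshold) / (3 * quota) = - 2 - 4 * ln p"
      using quota_pos side_pos unfolding W_def quota_side(1) threshold_def
      by (simp add: field_simps)
    also have "exp (- 2 - 4 * ln p) \<le> exp (- 4 * ln p)" by simp
    finally show ?thesis unfolding exp_ln_p x(1) .
  qed
  let ?Z = "(\<Union>x\<in>snd ` E \<times> {..<side}. ?A x) \<union> ((\<Union>c\<in>{..<side}. ?B c) \<union> (\<Union>x\<in>{..<side} \<times> {..<side}. ?C x))"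
  have "measure_pmf.prob hash_pmf {g. \<exists>c<side. \<exists>c'<side.
      threshold < real (card {(a, b) \<in> S i. weight_of st i a \<noteq> Heavy \<and> weight_of st (nxt i) b \<noteq> Heavy \<and>
           g (i, side, a) = c \<and> g (nxt i, side, b) = c'})} \<le> measure_pmf.prob hash_pmf ?Z"
  proof (rule measure_pmf.finite_measure_mono)
    show "{g. \<exists>c<side. \<exists>c'<side.
      threshold < real (card {(a, b) \<in> S i. weight_of st i a \<noteq> Heavy \<and> weight_of st (nxt i) b \<noteq> Heavy \<and>
           g (i, side, a) = c \<and> g (nxt i, side, b) = c'})} \<subseteq> ?Z"
    proof
      fix g :: hash
      assume "g \<in> {g. \<exists>c<side. \<exists>c'<side.
        threshold < real (card {(a, b) \<in> S i. weight_of st i a \<noteq> Heavy \<and> weight_of st (nxt i) b \<noteq> Heavy \<and>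
           g (i, side, a) = c \<and> g (nxt i, side, b) = c'})}"
      then obtain c c' where c: "c < side" "c' < side" and
        "threshold < real (card {(a, b) \<in> S i. weight_of st i a \<noteq> Heavy \<and> weight_of st (nxt i) b \<noteq> Heavy \<and>
           g (i, side, a) = c \<and> g (nxt i, side, b) = c'})" by blast
      moreover have "{(a, b) \<in> S i. weight_of st i a \<noteq> Heavy \<and> weight_of st (nxt i) b \<noteq> Heavy \<and>
           g (i, side, a) = c \<and> g (nxt i, side, b) = c'} = {(a, b) \<in> E. g (i, side, a) = c \<and> g (nxt i, side, b) = c'}"
        by (auto simp: E_def)
      ultimately have t: "threshold \<le> real (card {(a, b) \<in> E. g (i, side, a) = c \<and> g (nxt i, side, b) = c'})"
        by simp
      show "g \<in> ?Z"
      proof (rule ccontr)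
        assume g: "g \<notin> ?Z"
        then have "g \<notin> ?B c" "\<forall>b\<in>snd ` E. g \<notin> ?A (b, c)" using c by blast+
        then have "g \<in> ?C (c, c')" using t by (auto simp: not_less)
        then show False using g c by blast
      qed
    qed
  qed simp
  also have "\<dots> \<le> measure_pmf.prob hash_pmf (\<Union>x\<in>snd ` E \<times> {..<side}. ?A x) +
      (measure_pmf.prob hash_pmf (\<Union>c\<in>{..<side}. ?B c) + measure_pmf.prob hash_pmf (\<Union>x\<in>{..<side} \<times> {..<side}. ?C x))"
    by (intro order_trans[OF measure_Un_le add_left_mono[OF measure_Un_le]]) auto
  also have "\<dots> \<le> real (card (snd ` E \<times> {..<side})) * exp (- quota) +
      (real (card {..<side}) * (1 / real p ^ 4) + real (card ({..<side} \<times> {..<side})) * (1 / real p ^ 4))"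
    by (intro add_mono prob_UN_le A B C) (use fin in auto)
  also have "\<dots> \<le> real m * side * exp (- quota) + (side + side\<^sup>2) / real p ^ 4"
  proof -
    have "card (snd ` E) \<le> m" using card_image_le[OF fin, of snd] card_E by linarith
    then have "real (card (snd ` E \<times> {..<side})) * exp (- quota) \<le> real m * side * exp (- quota)"
      unfolding card_cartesian_product by (intro mult_right_mono) (simp_all add: mult_right_mono)
    then show ?thesis by (simp add: card_cartesian_product add_divide_distrib power2_eq_square)
  qed
  finally show ?thesis .
qed

text \<open>No bound on \<open>m\<close> in terms of \<open>p\<close> is available, but
  \<open>m\<close> equals \<open>quota * side\<^sup>2\<close>, and \<open>exp quota\<close> is at
  least \<open>quota ^ 4 / 64\<close>. What remains is \<open>side ^ 3 * 64 / quota ^ 3\<close> with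
  \<open>quota \<ge> p ^ 3\<close>.\<close>

lemma grid_error_le: "real m * side * exp (- quota) + (side + side\<^sup>2) / real p ^ 4 \<le> 69 / p"
proof -
  have p1: "real p \<ge> 1" using p by simp
  have "quota\<^sup>2 / 8 \<le> exp (quota / 2)"
    using exp_lower_Taylor_quadratic[of "quota / 2"] quota_pos by (simp add: power2_eq_square)
  then have "(quota\<^sup>2 / 8)\<^sup>2 \<le> (exp (quota / 2))\<^sup>2"
    by (intro power_mono) auto
  then have "quota ^ 4 / 64 \<le> exp quota"
    by (simp add: power_divide exp_double[symmetric])
  then have "quota * exp (- quota) \<le> 64 / quota ^ 3"
    using quota_pos by (simp add: exp_minus field_simps power_numeral_reduce)
  also have "\<dots> \<le> 64 / (real p ^ 3) ^ 3"
    using quota_ge p1 quota_pos by (intro divide_left_mono power_mono mult_pos_pos) auto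
  finally have e: "quota * exp (- quota) \<le> 64 / real p ^ 9" by (simp flip: power_mult)
  have "real m * side * exp (- quota) = real side ^ 3 * (quota * exp (- quota))"
    using side_pos by (simp add: quota_def field_simps power_numeral_reduce)
  also have "\<dots> \<le> real p ^ 3 * (64 / real p ^ 9)"
    using side_le_p e quota_pos by (intro mult_mono power_mono) auto
  also have "\<dots> = 64 / p * (1 / real p ^ 5)"
    using p by (simp add: field_simps power_numeral_reduce)
  also have "\<dots> \<le> 64 / p * 1" using p1 by (intro mult_left_mono) auto
  finally have 1: "real m * side * exp (- quota) \<le> 64 / p" by simp
  have "real (side + side\<^sup>2) \<le> real (5 * p)"
    using side_le_p side_square_le_p by (simp only: of_nat_le_iff)
  then have "real (side + side\<^sup>2) / real p ^ 4 \<le> 5 * p / real p ^ 4"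
    by (intro divide_right_mono) auto
  also have "\<dots> = 5 / p * (1 / real p ^ 2)"
    using p by (simp add: field_simps power_numeral_reduce)
  also have "\<dots> \<le> 5 / p * 1" using p1 by (intro mult_left_mono) auto
  finally show ?thesis using 1 by simp
qed

text \<open>Union bound with 91 = 5 + 5 + 12 + 69: \<open>p + side\<^sup>2 \<le> 5 * p\<close> light
  buckets on either side, \<open>3 * side\<^sup>2 \<le> 12 * p\<close> fan buckets, and the grid
  error.\<close>

lemma prob_not_spread_le: "measure_pmf.prob hash_pmf {g. \<not> spread threshold g} \<le> 91 * real k / real p"
proof -
  define I where "I = (SIGMA i:{..<k}. SIGMA q:{p, side\<^sup>2}. {..<q})"
  define H where "H i = {h \<in> {1..n}. weight_of st (nxt i) h = Heavy}" for i
  define J where "J = (SIGMA i:{..<k}. SIGMA h:H i. {..<fan st i h})"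
  let ?L = "\<lambda>(i, q, c). {g :: hash. threshold < real (card {(a, b) \<in> S i. weight_of st i a = Light \<and> g (i, q, a) = c})}"
  let ?R = "\<lambda>(i, q, c). {g :: hash. threshold < real (card {(a, b) \<in> S i. weight_of st (nxt i) b = Light \<and> g (nxt i, q, b) = c})}"
  let ?F = "\<lambda>(i, h, c). {g :: hash. threshold < real (card {a. (a, h) \<in> S i \<and> g (i, fan st i h, a) = c})}"
  let ?G = "\<lambda>i. {g :: hash. \<exists>c<side. \<exists>c'<side.
      threshold < real (card {(a, b) \<in> S i. weight_of st i a \<noteq> Heavy \<and> weight_of st (nxt i) b \<noteq> Heavy \<and>
           g (i, side, a) = c \<and> g (nxt i, side, b) = c'})}"
  have fin: "finite I" "finite J" by (auto simp: I_def J_def H_def)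
  have "card I = (\<Sum>i<k. \<Sum>q\<in>{p, side\<^sup>2}. q)" by (simp add: I_def)
  also have "\<dots> \<le> (\<Sum>i<k. p + side\<^sup>2)" by (intro sum_mono) (simp add: sum.insert_if)
  also have "\<dots> \<le> 5 * k * p" using side_square_le_p by simp
  finally have card_I: "card I \<le> 5 * k * p" .
  have "card J = (\<Sum>i<k. \<Sum>h\<in>H i. fan st i h)" by (simp add: J_def H_def)
  also have "\<dots> \<le> (\<Sum>i<k. 3 * side\<^sup>2)"
    unfolding H_def using sum_fan by (intro sum_mono) auto
  also have "\<dots> \<le> 12 * k * p" using side_square_le_p by simp
  finally have card_J: "card J \<le> 12 * k * p" .
  have few: "real N * (1 / real p ^ 4) \<le> real a / p" if "N \<le> a * p" for N a
  proof -
    have "real N * (1 / real p ^ 4) \<le> real (a * p) * (1 / real p ^ 4)"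
      using that by (intro mult_right_mono) (simp_all only: of_nat_le_iff, simp)
    also have "\<dots> = real a / p * (1 / real p ^ 2)"
      using p by (simp add: field_simps power_numeral_reduce)
    also have "\<dots> \<le> real a / p * 1" using p by (intro mult_left_mono) (auto simp: divide_le_eq)
    finally show ?thesis by simp
  qed
  have L: "measure_pmf.prob hash_pmf (\<Union>x\<in>I. ?L x) \<le> real (card I) * (1 / real p ^ 4)"
    by (rule prob_UN_le[OF fin(1)]) (use overflow_left in \<open>auto simp: I_def\<close>)
  have R: "measure_pmf.prob hash_pmf (\<Union>x\<in>I. ?R x) \<le> real (card I) * (1 / real p ^ 4)"
    by (rule prob_UN_le[OF fin(1)]) (use overflow_right in \<open>auto simp: I_def\<close>)
  have F: "measure_pmf.prob hash_pmf (\<Union>x\<in>J. ?F x) \<le> real (card J) * (1 / real p ^ 4)"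
    by (rule prob_UN_le[OF fin(2)]) (use overflow_fan in \<open>auto simp: J_def\<close>)
  have G: "measure_pmf.prob hash_pmf (\<Union>i<k. ?G i) \<le> real (card {..<k}) * (69 / p)"
    by (rule prob_UN_le) (auto intro: order_trans[OF overflow_grid grid_error_le])
  have "{g. \<not> spread threshold g} \<subseteq> (\<Union>x\<in>I. ?L x) \<union> ((\<Union>x\<in>I. ?R x) \<union> ((\<Union>x\<in>J. ?F x) \<union> (\<Union>i<k. ?G i)))"
  proof
    fix g :: hash assume "g \<in> {g. \<not> spread threshold g}"
    then have "\<not> spread threshold g" by simp
    show "g \<in> (\<Union>x\<in>I. ?L x) \<union> ((\<Union>x\<in>I. ?R x) \<union> ((\<Union>x\<in>J. ?F x) \<union> (\<Union>i<k. ?G i)))"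
    proof (rule ccontr)
      assume g: "g \<notin> (\<Union>x\<in>I. ?L x) \<union> ((\<Union>x\<in>I. ?R x) \<union> ((\<Union>x\<in>J. ?F x) \<union> (\<Union>i<k. ?G i)))"
      have "g \<notin> ?L (i, q, c) \<and> g \<notin> ?R (i, q, c)" if "i < k" "q \<in> {p, side\<^sup>2}" "c < q" for i q c
      proof -
        have "(i, q, c) \<in> I" using that by (auto simp: I_def)
        then show ?thesis using g by blast
      qed
      moreover have "g \<notin> ?F (i, h, c)"
        if "i < k" "h \<in> {1..n}" "weight_of st (nxt i) h = Heavy" "c < fan st i h" for i h c
      proof -
        have "(i, h, c) \<in> J" using that by (auto simp: J_def H_def)
        then show ?thesis using g by blast
      qed
      moreover have "\<not> threshold < real (card {(a, b) \<in> S i. weight_of st i a \<noteq> Heavy \<and>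
          weight_of st (nxt i) b \<noteq> Heavy \<and> g (i, side, a) = c \<and> g (nxt i, side, b) = c'})"
        if "i < k" "c < side" "c' < side" for i c c'
        using g that by blast
      ultimately have "spread threshold g"
        unfolding spread_def by (simp add: not_less)
      then show False using \<open>\<not> spread threshold g\<close> by blast
    qed
  qed
  then have "measure_pmf.prob hash_pmf {g. \<not> spread threshold g}
      \<le> measure_pmf.prob hash_pmf ((\<Union>x\<in>I. ?L x) \<union> ((\<Union>x\<in>I. ?R x) \<union> ((\<Union>x\<in>J. ?F x) \<union> (\<Union>i<k. ?G i))))"
    by (rule measure_pmf.finite_measure_mono) simp
  also have "\<dots> \<le> measure_pmf.prob hash_pmf (\<Union>x\<in>I. ?L x) + (measure_pmf.prob hash_pmf (\<Union>x\<in>I. ?R x)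
      + (measure_pmf.prob hash_pmf (\<Union>x\<in>J. ?F x) + measure_pmf.prob hash_pmf (\<Union>i<k. ?G i)))"
    by (intro order_trans[OF measure_Un_le] add_left_mono) auto
  also have "\<dots> \<le> real (5 * k) / p + (real (5 * k) / p + (real (12 * k) / p + k * (69 / p)))"
    using L R F G few[OF card_I] few[OF card_J] by (intro add_mono) auto
  also have "\<dots> = 91 * real k / real p" using p by (simp add: field_simps)
  finally show ?thesis .
qed

section \<open>The load bound in bits and its probability\<close>

lemma load_le_of_spread:
  assumes spread: "spread threshold (hash_of \<omega>)" and p2: "p \<ge> 2"
  shows "real (load alg p st D \<omega>)
     \<le> (real k + 4) * (18 ^ k + 1) * 40 * real k * ln p * (size_bits n m / real p powr (2 / real k))"
proof -
  let ?B = "(18 ^ k + 1) * (2 * k * threshold)"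
  have p1: "real p \<ge> 1" using p by simp
  have "threshold \<ge> 10 * quota"
    unfolding threshold_def using ln_p quota_pos by (simp add: distrib_left)
  then have T: "threshold \<ge> 10 * real p ^ 3" using quota_ge by linarith
  then have T0: "threshold \<ge> 0" by (rule order_trans[rotated]) simp
  \<comment> \<open>Compared with \<open>threshold\<close>, the broadcast of round one is of lower
    order.\<close>
  have "4 * real p ^ 2 \<le> 10 * real p ^ 3"
    using mult_mono[of 4 10 "real p ^ 2" "real p ^ 3"] power_increasing[of 2 3 "real p"] p1 by simp
  also have "\<dots> \<le> threshold" by (rule T)
  also have "\<dots> \<le> 18 ^ k * 2 * threshold"
  proof -
    have "(1 :: real) * 1 \<le> 18 ^ k * 2" by (intro mult_mono) auto
    then have "1 * threshold \<le> 18 ^ k * 2 * threshold" using T0 by (intro mult_right_mono) simp_all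
    then show ?thesis by simp
  qed
  finally have "k * (4 * real p ^ 2 + 2 * threshold) \<le> k * (18 ^ k * 2 * threshold + 2 * threshold)"
    by (intro mult_left_mono add_right_mono) auto
  then have r1: "k * (4 * real p ^ 2 + 2 * threshold) \<le> ?B" by (simp add: algebra_simps)
  have load: "real (load alg p st D \<omega>) \<le> fact_bits k n * ?B"
  proof (rule load_le)
    show "real (\<Sum>t<p. card (D t \<inter> round1 st (hash_of \<omega>) s)) \<le> ?B" if "s < p" for s
      using round1_le[OF spread that] r1 by (rule order_trans)
    show "real (\<Sum>t<p. card (round2 st (hash_of \<omega>) (known1 (hash_of \<omega>) t) t s)) \<le> ?B" for s
      using round2_le[OF spread T0, of s] by simp
  qed (use T0 in simp)
  \<comment> \<open>A domain with at most one value admits at most one tuple, whereas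
    \<open>m\<close> is at least 32. So \<open>log 2 n\<close> is at least 1.\<close>
  have n2: "n \<ge> 2"
  proof (rule ccontr)
    assume "\<not> n \<ge> 2"
    then have "card ({1..n} \<times> {1..n}) \<le> 1" by (cases n) (auto simp: card_cartesian_product)
    moreover have "m \<le> card ({1..n} \<times> {1..n})"
      using card_mono[OF _ S_subset[of 0]] card_S[of 0] k by simp
    moreover have "real p ^ 5 \<ge> 2 ^ 5" using p2 by (intro power_mono) auto
    then have "real m \<ge> 2 ^ 5" using m by (rule order_trans)
    then have "m > 1" by simp
    ultimately show False by simp
  qed
  \<comment> \<open>From \<open>p = 2\<close> on, \<open>ln p\<close> exceeds 1/2, so the additive
    10 is absorbed.\<close>
  have "ln (real p) \<ge> ln 2" using p2 by simp
  then have ln: "10 + 20 * ln (real p) \<le> 40 * ln p"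
    using ln2_ge_two_thirds by linarith
  have "real p powr (1 / real k) \<le> side" unfolding side_def by linarith
  then have "(real p powr (1 / real k))\<^sup>2 \<le> (real side)\<^sup>2" by (intro power_mono) auto
  moreover have "(real p powr (1 / real k))\<^sup>2 = real p powr (2 / real k)"
    using p by (simp add: powr_powr flip: powr_numeral)
  ultimately have "quota \<le> real m / real p powr (2 / real k)"
    unfolding quota_def using p by (intro divide_left_mono mult_pos_pos) (auto simp: side_pos)
  then have "threshold \<le> real m / real p powr (2 / real k) * (40 * ln p)"
    unfolding threshold_def using ln ln_p by (intro mult_mono) auto
  then have B: "?B \<le> (18 ^ k + 1) * (2 * k * (real m / real p powr (2 / real k) * (40 * ln p)))"
    by (intro mult_left_mono) auto
  have "fact_bits k n * ?B
      \<le> ((real k + 4) * log 2 n) * ((18 ^ k + 1) * (2 * k * (real m / real p powr (2 / real k) * (40 * ln p))))"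
    using fact_bits_le[OF n2, of k] B by (rule mult_mono) (use T0 n2 in auto)
  also have "\<dots> = (real k + 4) * (18 ^ k + 1) * 40 * real k * ln p * (size_bits n m / real p powr (2 / real k))"
    by (simp add: size_bits_def field_simps)
  finally show ?thesis using load by simp
qed

lemma prob_load_le:
  "measure_pmf.prob (seed_dist alg)
     {\<omega>. real (load alg p st D \<omega>)
        \<le> (real k + 4) * (18 ^ k + 1) * 40 * real k * ln p ^ 1 * (size_bits n m / real p powr (2 / real k))}
     \<ge> 1 - 91 * real k / real p" (is "measure_pmf.prob _ ?good \<ge> _")
proof (cases "p \<ge> 2")
  case False
  \<comment> \<open>A single server would need load 0, as \<open>ln 1 = 0\<close>; but the claimed
    probability is then not positive.\<close>
  then have "p = 1" using p by simp
  then have "1 - 91 * real k / p \<le> 0" using k by simp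
  then show ?thesis by (meson measure_nonneg order_trans)
next
  case True
  let ?e = "to_nat_on (set_pmf hash_pmf)"
  have "1 - 91 * real k / real p \<le> 1 - measure_pmf.prob hash_pmf {g. \<not> spread threshold g}"
    using prob_not_spread_le by simp
  also have "\<dots> = measure_pmf.prob hash_pmf {g. spread threshold g}"
  proof -
    have "{g. spread threshold g} = UNIV - {g. \<not> spread threshold g}" by auto
    then show ?thesis using measure_pmf.prob_compl[of "{g. \<not> spread threshold g}" hash_pmf] by simp
  qed
  \<comment> \<open>Seeds decode to their hash function on the support only.\<close>
  also have "\<dots> = measure_pmf.prob hash_pmf ({g. spread threshold g} \<inter> set_pmf hash_pmf)"
    by (simp add: measure_Int_set_pmf)
  also have "\<dots> \<le> measure_pmf.prob hash_pmf (?e -` ?good)"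
  proof (rule measure_pmf.finite_measure_mono)
    show "{g. spread threshold g} \<inter> set_pmf hash_pmf \<subseteq> ?e -` ?good"
    proof
      fix g assume g: "g \<in> {g. spread threshold g} \<inter> set_pmf hash_pmf"
      then have "hash_of (?e g) = g" by (simp add: hash_of_def)
      then have "spread threshold (hash_of (?e g))" using g by simp
      from load_le_of_spread[OF this True] show "g \<in> ?e -` ?good" by simp
    qed
  qed simp
  also have "\<dots> = measure_pmf.prob (seed_dist alg) ?good" by (simp add: alg_def)
  finally show ?thesis .
qed

end

theorem lemma4p6:
  fixes k :: nat
  assumes "k \<ge> 3"
  shows "\<exists>(A :: nat \<Rightarrow> nat \<Rightarrow> mpc_algorithm) (c :: real) (C :: real) (d :: nat) (\<epsilon> :: nat \<Rightarrow> real).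
    c > 1 \<and> \<epsilon> \<longlonglongrightarrow> 0 \<and>
    (\<forall>p n. int (num_rounds (A p n)) \<le> \<lceil>real k / 2\<rceil>) \<and>
    (\<forall>p n m S D.
       p \<ge> 1 \<and> real m \<ge> real p powr c \<and>
       is_input (cycle_query k) n m S \<and> even_partition p (cycle_query k) S D \<longrightarrow>
       (let st = data_statistics p (cycle_query k) S in
          (\<forall>\<omega> \<in> set_pmf (seed_dist (A p n)).
             mpc_output (A p n) p st D \<omega> = answers k (cycle_query k) S) \<and>
          measure_pmf.prob (seed_dist (A p n))
            {\<omega>. real (load (A p n) p st D \<omega>)
                 \<le> C * ln (real p) ^ d * (size_bits n m / real p powr (2 / real k))}
            \<ge> 1 - \<epsilon> p))"
proof (intro exI conjI allI impI)
  show "(5 :: real) > 1" by simp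
  show "(\<lambda>p. 91 * real k / real p) \<longlonglongrightarrow> 0" by real_asymp
  \<comment> \<open>Two rounds are within the limit, since half of \<open>k\<close> exceeds 1 for
    \<open>k \<ge> 3\<close>.\<close>
  show "int (num_rounds (cycle_algorithm.alg k p n)) \<le> \<lceil>real k / 2\<rceil>" for p n
    using assms by (simp add: cycle_algorithm.alg_def le_ceiling_iff)
  fix p n m S D
  assume *: "p \<ge> 1 \<and> real m \<ge> real p powr 5 \<and>
       is_input (cycle_query k) n m S \<and> even_partition p (cycle_query k) S D"
  interpret cycle_input k p n m S D
    by unfold_locales (use * assms in \<open>auto simp: powr_numeral\<close>)
  show "let st = data_statistics p (cycle_query k) S in
          (\<forall>\<omega> \<in> set_pmf (seed_dist (cycle_algorithm.alg k p n)).
             mpc_output (cycle_algorithm.alg k p n) p st D \<omega> = answers k (cycle_query k) S) \<and>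
          measure_pmf.prob (seed_dist (cycle_algorithm.alg k p n))
            {\<omega>. real (load (cycle_algorithm.alg k p n) p st D \<omega>)
                 \<le> (real k + 4) * (18 ^ k + 1) * 40 * real k * ln (real p) ^ 1 * (size_bits n m / real p powr (2 / real k))}
            \<ge> 1 - 91 * real k / real p"
    unfolding Let_def using output_correct by (intro conjI ballI prob_load_le)
qed

end
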